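(* For every $1\le p<\infty$, there exists a holomorphic function $f\in\mathcal H(\ell_1;\ell_p)$ such that $f$ is $p$-compact at $0$, with $\limsup_{m\to\infty}\kappa_p(P_mf(0))^{1/m}=1$, but $f$ is not $p$-compact at $e_1$, where $e_1$ is the first element of the canonical basis of $\ell_1$.
   Context: Spaces are complex; $B_E$ is the closed unit ball of $E$. $\mathcal H(E;F)$ is the space of entire functions $f:E\to F$ between Banach spaces; for $y\in E$, $P_mf(y)$ are the continuous $m$-homogeneous polynomials from $E$ to $F$ such that $f(x)=\sum_{m\ge0}P_mf(y)(x-y)$ uniformly for $x$ in some neighborhood of $y$. $\ell_p(F)$ is the Banach space of $p$-summable sequences in $F$ with its natural norm $\|\cdot\|_p$. For $1\le p<\infty$, $\frac1p+\frac1q=1$, and $(y_n)_n\in\ell_p(F)$, put $p\text{-co}\{y_n\}=\{\sum_n\alpha_ny_n:(\alpha_n)_n\in B_{\ell_q}\}$. A set $K\subset F$ is relatively $p$-compact if it is contained in the closure of $p\text{-co}\{y_n\}$ for some $(y_n)_n\in\ell_p(F)$, and $m_p(K)=\inf\{\|(y_n)_n\|_p:K\subset p\text{-co}\{y_n\}\}$. A continuous homogeneous polynomial $P:E\to F$ is $p$-compact if $P(B_E)$ is relatively $p$-compact, and then $\kappa_p(P)=m_p(P(B_E))$. A function $f\in\mathcal H(E;F)$ is $p$-compact at $x_0$ if there is a neighborhood $V$ of $x_0$ such that $f(V)$ is relatively $p$-compact in $F$. *)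

theory Defs
  imports "HOL-Analysis.Analysis" "HOL-Library.Function_Algebras"
begin

section \<open>Complex vector spaces\<close>

class complex_vector = ab_group_add +
  fixes scaleC :: "complex \<Rightarrow> 'a \<Rightarrow> 'a" (infixr "*\<^sub>C" 75)
  assumes scaleC_add_right: "c *\<^sub>C (x + y) = c *\<^sub>C x + c *\<^sub>C y"
    and scaleC_add_left: "(c + d) *\<^sub>C x = c *\<^sub>C x + d *\<^sub>C x"
    and scaleC_scaleC: "c *\<^sub>C (d *\<^sub>C x) = (c * d) *\<^sub>C x"
    and scaleC_one: "1 *\<^sub>C x = x"

instantiation complex :: complex_vector
begin

definition scaleC_complex :: "complex \<Rightarrow> complex \<Rightarrow> complex"
  where "scaleC_complex c x = c * x"

instance
  by standard (simp_all add: scaleC_complex_def algebra_simps)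

end

instantiation "fun" :: (type, complex_vector) complex_vector
begin

definition scaleC_fun :: "complex \<Rightarrow> ('a \<Rightarrow> 'b) \<Rightarrow> 'a \<Rightarrow> 'b"
  where "scaleC_fun c f = (\<lambda>x. c *\<^sub>C f x)"

instance
  by standard
    (simp_all add: scaleC_fun_def fun_eq_iff scaleC_add_right scaleC_add_left
      scaleC_scaleC scaleC_one)

end

section \<open>Normed spaces with an explicit carrier\<close>

text \<open>
  The space of \<open>p\<close>-summable sequences depends on the real number \<open>p\<close>, so it cannot be a type.
  A complex normed space is therefore given by a linear subspace of an ambient complex vector
  space together with a norm, of which only the values on that subspace matter.
\<close>

record 'a nspace =
  ncarrier :: "'a set"
  nnorm :: "'a \<Rightarrow> real"

text \<open>
  The value off the carrier is fixed because the library's \<^locale>\<open>Metric_space\<close> requires the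
  distance to be nonnegative and symmetric on the whole type.
\<close>

definition ndist :: "('a::complex_vector) nspace \<Rightarrow> 'a \<Rightarrow> 'a \<Rightarrow> real"
  where "ndist E x y = (if x \<in> ncarrier E \<and> y \<in> ncarrier E then nnorm E (x - y) else 0)"

definition ntopology :: "('a::complex_vector) nspace \<Rightarrow> 'a topology"
  where "ntopology E = Metric_space.mtopology (ncarrier E) (ndist E)"

definition unit_cball :: "'a nspace \<Rightarrow> 'a set"
  where "unit_cball E = {x \<in> ncarrier E. nnorm E x \<le> 1}"

definition complex_nspace :: "complex nspace"
  where "complex_nspace = \<lparr>ncarrier = UNIV, nnorm = norm\<rparr>"

definition lp :: "real \<Rightarrow> 'a nspace \<Rightarrow> (nat \<Rightarrow> 'a) nspace"
  where "lp p F =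
    \<lparr>ncarrier = {y. (\<forall>n. y n \<in> ncarrier F) \<and> summable (\<lambda>n. nnorm F (y n) powr p)},
     nnorm = (\<lambda>y. (\<Sum>n. nnorm F (y n) powr p) powr (1 / p))\<rparr>"

definition linf :: "'a nspace \<Rightarrow> (nat \<Rightarrow> 'a) nspace"
  where "linf F =
    \<lparr>ncarrier = {y. (\<forall>n. y n \<in> ncarrier F) \<and> bdd_above (range (\<lambda>n. nnorm F (y n)))},
     nnorm = (\<lambda>y. SUP n. nnorm F (y n))\<rparr>"

abbreviation ell :: "real \<Rightarrow> (nat \<Rightarrow> complex) nspace"
  where "ell p \<equiv> lp p complex_nspace"

text \<open>Scalar sequences with the exponent \<open>q\<close> conjugate to \<open>p\<close>, that is \<open>1/p + 1/q = 1\<close>.\<close>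

definition ell_conj :: "real \<Rightarrow> (nat \<Rightarrow> complex) nspace"
  where "ell_conj p = (if p = 1 then linf complex_nspace else ell (p / (p - 1)))"

text \<open>Coordinates are indexed from \<open>0\<close>, so the first canonical basis vector is \<open>unit_seq 0\<close>.\<close>

definition unit_seq :: "nat \<Rightarrow> nat \<Rightarrow> complex"
  where "unit_seq k = (\<lambda>n. if n = k then 1 else 0)"

section \<open>Homogeneous polynomials and entire functions\<close>

text \<open>An \<open>m\<close>-tuple of vectors is a list of length \<open>m\<close>.\<close>

definition multilinear_on ::
  "('a::complex_vector) nspace \<Rightarrow> ('b::complex_vector) nspace \<Rightarrow> nat \<Rightarrow> ('a list \<Rightarrow> 'b) \<Rightarrow> bool"
  where "multilinear_on E F m A \<longleftrightarrow>
    (\<forall>xs. length xs = m \<and> set xs \<subseteq> ncarrier E \<longrightarrow>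
      A xs \<in> ncarrier F \<and>
      (\<forall>i<m. \<forall>x\<in>ncarrier E. \<forall>y\<in>ncarrier E. \<forall>c.
        A (xs[i := x + y]) = A (xs[i := x]) + A (xs[i := y]) \<and>
        A (xs[i := c *\<^sub>C x]) = c *\<^sub>C A (xs[i := x])))"

definition cont_hom_poly ::
  "('a::complex_vector) nspace \<Rightarrow> ('b::complex_vector) nspace \<Rightarrow> nat \<Rightarrow> ('a \<Rightarrow> 'b) \<Rightarrow> bool"
  where "cont_hom_poly E F m P \<longleftrightarrow>
    (\<exists>A. multilinear_on E F m A \<and> (\<forall>x\<in>ncarrier E. P x = A (replicate m x))) \<and>
    continuous_map (ntopology E) (ntopology F) P"

definition has_taylor_expansion ::
  "('a::complex_vector) nspace \<Rightarrow> ('b::complex_vector) nspace \<Rightarrow> ('a \<Rightarrow> 'b) \<Rightarrow> 'a \<Rightarrow>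
    (nat \<Rightarrow> 'a \<Rightarrow> 'b) \<Rightarrow> bool"
  where "has_taylor_expansion E F f y P \<longleftrightarrow>
    (\<forall>m. cont_hom_poly E F m (P m)) \<and>
    (\<exists>V. openin (ntopology E) V \<and> y \<in> V \<and>
      uniform_limit V (\<lambda>n x. nnorm F (f x - (\<Sum>m<n. P m (x - y)))) (\<lambda>_. 0) sequentially)"

definition entire ::
  "('a::complex_vector) nspace \<Rightarrow> ('b::complex_vector) nspace \<Rightarrow> ('a \<Rightarrow> 'b) set"
  where "entire E F = {f. f \<in> ncarrier E \<rightarrow> ncarrier F \<and>
    (\<forall>y\<in>ncarrier E. \<exists>P. has_taylor_expansion E F f y P)}"

text \<open>
  \<open>taylor_poly E F f y m\<close> is the polynomial \<open>P\<^sub>m f(y)\<close>. The expansion is unique on the carrier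
  of \<open>E\<close>; the choice only concerns values off the carrier.
\<close>

definition taylor_poly ::
  "('a::complex_vector) nspace \<Rightarrow> ('b::complex_vector) nspace \<Rightarrow> ('a \<Rightarrow> 'b) \<Rightarrow> 'a \<Rightarrow>
    nat \<Rightarrow> 'a \<Rightarrow> 'b"
  where "taylor_poly E F f y = (SOME P. has_taylor_expansion E F f y P)"

section \<open>\<open>p\<close>-compactness\<close>

definition p_co :: "real \<Rightarrow> ('a::complex_vector) nspace \<Rightarrow> (nat \<Rightarrow> 'a) \<Rightarrow> 'a set"
  where "p_co p F y = {z. \<exists>\<alpha>\<in>unit_cball (ell_conj p).
    limitin (ntopology F) (\<lambda>N. \<Sum>n<N. \<alpha> n *\<^sub>C y n) z sequentially}"

definition rel_p_compact :: "real \<Rightarrow> ('a::complex_vector) nspace \<Rightarrow> 'a set \<Rightarrow> bool"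
  where "rel_p_compact p F K \<longleftrightarrow>
    (\<exists>y\<in>ncarrier (lp p F). K \<subseteq> ntopology F closure_of p_co p F y)"

definition m_p :: "real \<Rightarrow> ('a::complex_vector) nspace \<Rightarrow> 'a set \<Rightarrow> real"
  where "m_p p F K = Inf {nnorm (lp p F) y | y. y \<in> ncarrier (lp p F) \<and> K \<subseteq> p_co p F y}"

definition p_compact_poly ::
  "real \<Rightarrow> ('a::complex_vector) nspace \<Rightarrow> ('b::complex_vector) nspace \<Rightarrow> ('a \<Rightarrow> 'b) \<Rightarrow> bool"
  where "p_compact_poly p E F P \<longleftrightarrow> rel_p_compact p F (P ` unit_cball E)"

definition kappa ::
  "real \<Rightarrow> ('a::complex_vector) nspace \<Rightarrow> ('b::complex_vector) nspace \<Rightarrow> ('a \<Rightarrow> 'b) \<Rightarrow> real"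
  where "kappa p E F P = m_p p F (P ` unit_cball E)"

definition p_compact_at ::
  "real \<Rightarrow> ('a::complex_vector) nspace \<Rightarrow> ('b::complex_vector) nspace \<Rightarrow> ('a \<Rightarrow> 'b) \<Rightarrow> 'a \<Rightarrow> bool"
  where "p_compact_at p E F f x0 \<longleftrightarrow>
    (\<exists>V. openin (ntopology E) V \<and> x0 \<in> V \<and> rel_p_compact p F (f ` V))"

end

(*
  Partition the natural numbers into blocks, block m having k_m = 2^(m^2) elements; d j is the block
  of j, and w m = k_m^(-1/p). The function is

    f(x)_j = w(d j) * x_0^(d j) * x_(j+1),

  whose homogeneous part of degree m + 1 at 0 is x_0^m times a diagonal map on block m. As w m decays
  faster than any geometric sequence, f is entire. The image of the unit ball of l_1 under the diagonal
  map on a block is not contained in p-co{y_n} with ||(y_n)||_p < (k_m * (w m)^p)^(1/p) = 1, because the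
  p-th powers of the coordinates add up; the factor x_0^m costs only the factor max x_0^m (1 - x_0),
  of order 1/m. So the m-th roots of the p-compact norms tend to 1. Around 0 the powers of x_0 provide
  geometric decay, whereas around the first basis vector every block contributes the same mass and
  the total is infinite.
*)
theory Submission
  imports Defs "HOL-Real_Asymp.Real_Asymp"
begin

section \<open>The spaces of summable scalar sequences\<close>

text \<open>Two norms of the same diagonal map are played against each other. From l_1 to l_p its
  operator norm is the size of one entry, \<open>w m\<close>, whereas its p-compact norm is the l_p
  norm of the whole diagonal. Entireness depends on the former and p-compactness on the latter.
  Keeping the l_p norm of each block equal to 1 while \<open>w\<close> beats every geometric
  sequence forces the block sizes to grow superexponentially; a quadratic exponent is a convenient
  choice. Two obstacles shape the proof. The p-compact norm is an infimum over all representing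
  sequences, so a lower bound has to hold for an arbitrary (y_n), and at the basis vector even for
  the closure of its p-convex hull. And \<open>taylor_poly\<close> is a choice among possible
  expansions, so uniqueness of the expansion on the carrier comes before any statement about the
  polynomials at 0.\<close>

lemma mem_ell: "x \<in> ncarrier (ell p) \<longleftrightarrow> summable (\<lambda>n. norm (x n) powr p)"
  by (simp add: lp_def complex_nspace_def)

lemma nnorm_ell: "nnorm (ell p) x = (\<Sum>n. norm (x n) powr p) powr (1 / p)"
  by (simp add: lp_def complex_nspace_def)

lemma nnorm_ell_nonneg: "0 \<le> nnorm (ell p) x"
  by (simp add: nnorm_ell)

lemma mem_ell_1: "x \<in> ncarrier (ell 1) \<longleftrightarrow> summable (\<lambda>n. norm (x n))"
  by (simp add: mem_ell)

lemma nnorm_ell_1: "x \<in> ncarrier (ell 1) \<Longrightarrow> nnorm (ell 1) x = (\<Sum>n. norm (x n))"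
  by (simp add: nnorm_ell mem_ell suminf_nonneg)

lemma nnorm_ell_powr:
  assumes "x \<in> ncarrier (ell p)" "1 \<le> p"
  shows "nnorm (ell p) x powr p = (\<Sum>n. norm (x n) powr p)"
  using assms by (simp add: nnorm_ell powr_powr mem_ell suminf_nonneg)

lemma powr_eq_mult_powr: "0 \<le> t \<Longrightarrow> t powr p = t * t powr (p - 1)" for t :: real
  by (cases "t = 0") (simp_all add: powr_diff)

text \<open>The contractive inclusion of l_1 in l_p, cast as a domination test: every term is at
  most the total G of the majorant, so its p-th power is at most G^(p-1) times the majorant. Most
  membership and norm estimates below reduce to an l_1 majorant in this way.\<close>

lemma ell_bound:
  assumes p: "1 \<le> p" and g: "summable g" and z: "\<And>n. norm (z n) \<le> g n"
  shows "z \<in> ncarrier (ell p)" and "nnorm (ell p) z \<le> suminf g"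
proof -
  have g0: "0 \<le> g n" for n using z[of n] norm_ge_zero[of "z n"] by linarith
  have G: "g n \<le> suminf g" for n
    using sum_le_suminf[OF g, of "{n}"] g0 by simp
  have *: "norm (z n) powr p \<le> suminf g powr (p - 1) * g n" for n
  proof -
    have "norm (z n) powr p = norm (z n) * norm (z n) powr (p - 1)"
      by (rule powr_eq_mult_powr) simp
    also have "\<dots> \<le> g n * suminf g powr (p - 1)"
      using p z[of n] G[of n] g0[of n] by (intro mult_mono powr_mono2) auto
    finally show ?thesis by (simp add: mult.commute)
  qed
  have s: "summable (\<lambda>n. norm (z n) powr p)"
    by (rule summable_comparison_test'[OF summable_mult[OF g], of 0]) (use * in auto)
  then show mem: "z \<in> ncarrier (ell p)" by (simp add: mem_ell)
  have "(\<Sum>n. norm (z n) powr p) \<le> (\<Sum>n. suminf g powr (p - 1) * g n)"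
    by (intro suminf_le * s summable_mult g)
  also have "\<dots> = suminf g powr (p - 1) * suminf g" by (rule suminf_mult[OF g])
  also have "\<dots> = suminf g powr p"
    using powr_eq_mult_powr[of "suminf g" p] suminf_nonneg[OF g] g0 by (simp add: mult.commute)
  finally have "(\<Sum>n. norm (z n) powr p) powr (1/p) \<le> (suminf g powr p) powr (1/p)"
    using p suminf_nonneg[OF s] by (intro powr_mono2) auto
  then show "nnorm (ell p) z \<le> suminf g"
    using p suminf_nonneg[OF g] g0 by (simp add: nnorm_ell powr_powr)
qed

lemma norm_le_nnorm_ell:
  assumes "x \<in> ncarrier (ell p)" "1 \<le> p"
  shows "norm (x n) \<le> nnorm (ell p) x"
proof -
  have "norm (x n) powr p \<le> (\<Sum>n. norm (x n) powr p)"
    using sum_le_suminf[of "\<lambda>n. norm (x n) powr p" "{n}"] assms by (simp add: mem_ell)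
  then have "(norm (x n) powr p) powr (1/p) \<le> (\<Sum>n. norm (x n) powr p) powr (1/p)"
    using assms by (intro powr_mono2) auto
  then show ?thesis using assms by (simp add: nnorm_ell powr_powr)
qed

lemma scaleC_ell:
  assumes "x \<in> ncarrier (ell p)" "1 \<le> p"
  shows "c *\<^sub>C x \<in> ncarrier (ell p)" and "nnorm (ell p) (c *\<^sub>C x) = norm c * nnorm (ell p) x"
proof -
  have *: "norm ((c *\<^sub>C x) n) powr p = norm c powr p * norm (x n) powr p" for n
    by (simp add: scaleC_fun_def scaleC_complex_def norm_mult powr_mult)
  show "c *\<^sub>C x \<in> ncarrier (ell p)"
    using assms by (simp add: mem_ell * summable_mult)
  show "nnorm (ell p) (c *\<^sub>C x) = norm c * nnorm (ell p) x"
    using assms by (simp add: nnorm_ell mem_ell * suminf_mult powr_mult suminf_nonneg powr_powr)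
qed

text \<open>Coordinates may vanish, so Minkowski's inequality needs convexity on the closed
  half-line. At an endpoint the claim reduces to w^p \<le> w for w in [0,1].\<close>

lemma convex_powr_Ici:
  assumes "1 \<le> p" "0 \<le> (s::real)" "0 \<le> t" "0 \<le> u" "0 \<le> v" "u + v = 1"
  shows "(u * s + v * t) powr p \<le> u * s powr p + v * t powr p"
proof -
  have le: "w powr p \<le> w" if "0 \<le> w" "w \<le> 1" for w :: real
    using that assms(1) powr_mono'[of 1 p w] by (cases "w = 0") auto
  consider "s = 0" | "t = 0" | "s > 0" "t > 0" using assms by linarith
  then show ?thesis
  proof cases
    case 1
    have "v powr p * t powr p \<le> v * t powr p" using le[of v] assms by (intro mult_right_mono) auto
    then show ?thesis using 1 assms by (simp add: powr_mult)
  next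
    case 2
    have "u powr p * s powr p \<le> u * s powr p" using le[of u] assms by (intro mult_right_mono) auto
    then show ?thesis using 2 assms by (simp add: powr_mult)
  next
    case 3
    have "convex_on {0<..} (\<lambda>x. x powr p)" using assms by (intro powr_convex)
    from convex_onD[OF this, of v s t] 3 assms
    have "((1 - v) * s + v * t) powr p \<le> (1 - v) * s powr p + v * t powr p" by simp
    moreover have "1 - v = u" using assms by simp
    ultimately show ?thesis by simp
  qed
qed

text \<open>Minkowski's inequality from convexity: x + y is s + t times the combination of x/s and
  y/t with weights s/(s+t) and t/(s+t). Positive upper bounds s and t replace the norms themselves,
  which may be zero; the excess is removed by letting it tend to 0.\<close>

lemma add_ell:
  assumes p: "1 \<le> p" and x: "x \<in> ncarrier (ell p)" and y: "y \<in> ncarrier (ell p)"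
  shows "x + y \<in> ncarrier (ell p)"
    and "nnorm (ell p) (x + y) \<le> nnorm (ell p) x + nnorm (ell p) y"
proof -
  define a where "a = nnorm (ell p) x"
  define b where "b = nnorm (ell p) y"
  have Minkowski: "x + y \<in> ncarrier (ell p) \<and> nnorm (ell p) (x + y) \<le> s + t"
    if st: "s > 0" "t > 0" "a \<le> s" "b \<le> t" for s t
  proof -
    let ?g = "\<lambda>n. (s + t) powr p * (s / (s + t) * (norm (x n) powr p / s powr p)
        + t / (s + t) * (norm (y n) powr p / t powr p))"
    have *: "norm ((x + y) n) powr p \<le> ?g n" for n
    proof -
      have "norm ((x + y) n) \<le> norm (x n) + norm (y n)" by (simp add: norm_triangle_ineq)
      also have "\<dots> = (s + t) * (s / (s + t) * (norm (x n) / s) + t / (s + t) * (norm (y n) / t))"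
        using st by (simp add: distrib_left)
      finally have "norm ((x + y) n) powr p
          \<le> ((s + t) * (s / (s + t) * (norm (x n) / s) + t / (s + t) * (norm (y n) / t))) powr p"
        using p by (intro powr_mono2) auto
      also have "\<dots> = (s + t) powr p * (s / (s + t) * (norm (x n) / s) + t / (s + t) * (norm (y n) / t)) powr p"
        using st by (subst powr_mult) auto
      also have "\<dots> \<le> (s + t) powr p * (s / (s + t) * (norm (x n) / s) powr p + t / (s + t) * (norm (y n) / t) powr p)"
        using st p by (intro mult_left_mono convex_powr_Ici) (auto simp flip: add_divide_distrib)
      also have "\<dots> = ?g n" using st by (simp add: powr_divide)
      finally show ?thesis .
    qed
    have sx: "summable (\<lambda>n. norm (x n) powr p)" and sy: "summable (\<lambda>n. norm (y n) powr p)"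
      using x y by (simp_all add: mem_ell)
    have sg: "summable ?g" by (intro summable_mult summable_add summable_divide sx sy)
    have s: "summable (\<lambda>n. norm ((x + y) n) powr p)"
      by (rule summable_comparison_test'[OF sg, of 0]) (use * in auto)
    have "(\<Sum>n. norm ((x + y) n) powr p) \<le> suminf ?g" by (intro suminf_le * s sg)
    also have "\<dots> = (s + t) powr p * (s / (s + t) * (a powr p / s powr p) + t / (s + t) * (b powr p / t powr p))"
      unfolding a_def b_def using p x y sx sy
      by (simp add: nnorm_ell_powr suminf_mult suminf_add[symmetric] suminf_divide summable_mult summable_divide summable_add)
    also have "\<dots> \<le> (s + t) powr p * (s / (s + t) * 1 + t / (s + t) * 1)"
      using st p nnorm_ell_nonneg[of p] unfolding a_def b_def
      by (intro mult_left_mono add_mono) (auto intro!: powr_mono2 simp: divide_le_eq)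
    also have "\<dots> = (s + t) powr p" using st by (simp add: add_divide_distrib[symmetric])
    finally have "(\<Sum>n. norm ((x + y) n) powr p) powr (1/p) \<le> ((s + t) powr p) powr (1/p)"
      using p suminf_nonneg[OF s] by (intro powr_mono2) auto
    then show ?thesis using s st p by (simp add: mem_ell nnorm_ell powr_powr)
  qed
  have ab: "0 \<le> a" "0 \<le> b" unfolding a_def b_def by (simp_all add: nnorm_ell_nonneg)
  show "x + y \<in> ncarrier (ell p)" using Minkowski[of "a + 1" "b + 1"] ab by simp
  have "nnorm (ell p) (x + y) \<le> a + b + e" if "e > 0" for e
    using Minkowski[of "a + e/2" "b + e/2"] ab that by simp
  then show "nnorm (ell p) (x + y) \<le> nnorm (ell p) x + nnorm (ell p) y"
    unfolding a_def b_def by (rule field_le_epsilon)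
qed

lemma diff_ell:
  assumes p: "1 \<le> p" and x: "x \<in> ncarrier (ell p)" and y: "y \<in> ncarrier (ell p)"
  shows "x - y \<in> ncarrier (ell p)"
proof -
  have "x - y = x + (-1) *\<^sub>C y" by (auto simp: scaleC_fun_def scaleC_complex_def)
  also have "\<dots> \<in> ncarrier (ell p)" by (intro add_ell(1)[OF p x] scaleC_ell(1)[OF y p])
  finally show ?thesis .
qed

lemma nnorm_ell_minus_commute: "nnorm (ell p) (x - y) = nnorm (ell p) (y - x)"
  by (simp add: nnorm_ell norm_minus_commute)

section \<open>The norm topology of \<open>ell p\<close>: neighbourhoods, limits, closure,
  continuity\<close>

lemma Metric_space_ell:
  assumes p: "1 \<le> p"
  shows "Metric_space (ncarrier (ell p)) (ndist (ell p))"
proof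
  show "ndist (ell p) x y = ndist (ell p) y x" for x y
    by (simp add: ndist_def nnorm_ell_minus_commute[of p x y])
  show "ndist (ell p) x y = 0 \<longleftrightarrow> x = y" if "x \<in> ncarrier (ell p)" "y \<in> ncarrier (ell p)" for x y
  proof
    assume "ndist (ell p) x y = 0"
    then have "nnorm (ell p) (x - y) = 0" using that by (simp add: ndist_def)
    then have "x n - y n = 0" for n using norm_le_nnorm_ell[OF diff_ell[OF p that] p, of n] by simp
    then show "x = y" by (intro ext) (use eq_iff_diff_eq_0 in blast)
  qed (simp add: ndist_def nnorm_ell)
  show "ndist (ell p) x z \<le> ndist (ell p) x y + ndist (ell p) y z"
    if "x \<in> ncarrier (ell p)" "y \<in> ncarrier (ell p)" "z \<in> ncarrier (ell p)" for x y z
    using add_ell(2)[OF p diff_ell[OF p that(1,2)] diff_ell[OF p that(2,3)]] that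
    by (simp add: ndist_def)
qed (simp add: ndist_def nnorm_ell_nonneg)

lemma topspace_ell: "1 \<le> p \<Longrightarrow> topspace (ntopology (ell p)) = ncarrier (ell p)"
  unfolding ntopology_def by (simp add: Metric_space.topspace_mtopology[OF Metric_space_ell])

lemma openin_ellD:
  assumes "1 \<le> p" "openin (ntopology (ell p)) V" "y \<in> V"
  obtains r where "r > 0" "y \<in> ncarrier (ell p)"
    "\<And>x. x \<in> ncarrier (ell p) \<Longrightarrow> nnorm (ell p) (x - y) < r \<Longrightarrow> x \<in> V"
proof -
  interpret Metric_space "ncarrier (ell p)" "ndist (ell p)" by (rule Metric_space_ell[OF assms(1)])
  from assms obtain r where r: "r > 0" "mball y r \<subseteq> V" and y: "y \<in> ncarrier (ell p)"
    unfolding ntopology_def openin_mtopology by blast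
  show ?thesis
  proof (rule that[OF r(1) y])
    fix x assume "x \<in> ncarrier (ell p)" "nnorm (ell p) (x - y) < r"
    then have "x \<in> mball y r" using y by (simp add: nnorm_ell_minus_commute[of p y x] ndist_def in_mball)
    then show "x \<in> V" using r by blast
  qed
qed

definition ell_ball :: "real \<Rightarrow> (nat \<Rightarrow> complex) \<Rightarrow> real \<Rightarrow> (nat \<Rightarrow> complex) set"
  where "ell_ball p y r = {x \<in> ncarrier (ell p). nnorm (ell p) (x - y) < r}"

lemma openin_ell_ball:
  assumes "1 \<le> p" "y \<in> ncarrier (ell p)"
  shows "openin (ntopology (ell p)) (ell_ball p y r)"
proof -
  interpret Metric_space "ncarrier (ell p)" "ndist (ell p)" by (rule Metric_space_ell[OF assms(1)])
  have "ell_ball p y r = mball y r"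
    unfolding ell_ball_def using assms by (auto simp: in_mball nnorm_ell_minus_commute[of p y] ndist_def)
  then show ?thesis by (simp add: ntopology_def)
qed

lemma limitin_ellI:
  assumes p: "1 \<le> p" and z: "z \<in> ncarrier (ell p)" and s: "\<And>n. s n \<in> ncarrier (ell p)"
    and lim: "(\<lambda>n. nnorm (ell p) (s n - z)) \<longlonglongrightarrow> 0"
  shows "limitin (ntopology (ell p)) s z sequentially"
proof -
  interpret Metric_space "ncarrier (ell p)" "ndist (ell p)" by (rule Metric_space_ell[OF p])
  show ?thesis
    unfolding ntopology_def limit_metric_sequentially
    using z s lim by (auto simp: ndist_def LIMSEQ_iff nnorm_ell_nonneg)
qed

lemma limitin_ell_coord:
  assumes p: "1 \<le> p" and lim: "limitin (ntopology (ell p)) s z sequentially"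
  shows "(\<lambda>n. s n j) \<longlonglongrightarrow> z j"
proof -
  interpret Metric_space "ncarrier (ell p)" "ndist (ell p)" by (rule Metric_space_ell[OF p])
  have z: "z \<in> ncarrier (ell p)"
    and *: "\<And>e. e > 0 \<Longrightarrow> \<exists>N. \<forall>n\<ge>N. s n \<in> ncarrier (ell p) \<and> ndist (ell p) (s n) z < e"
    using lim unfolding ntopology_def limit_metric_sequentially by auto
  show ?thesis
  proof (rule LIMSEQ_I)
    fix e :: real assume "e > 0"
    from *[OF this] obtain N where N: "\<And>n. n \<ge> N \<Longrightarrow> s n \<in> ncarrier (ell p) \<and> ndist (ell p) (s n) z < e"
      by blast
    have "norm (s n j - z j) < e" if "n \<ge> N" for n
      using norm_le_nnorm_ell[OF diff_ell[OF p conjunct1[OF N[OF that]] z] p, of j] N[OF that] z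
      by (simp add: ndist_def split: if_splits)
    then show "\<exists>N. \<forall>n\<ge>N. norm (s n j - z j) < e" by blast
  qed
qed

lemma closure_of_ellD:
  assumes p: "1 \<le> p" and z: "z \<in> ntopology (ell p) closure_of S" and e: "e > 0"
  obtains w where "w \<in> S" "norm (z j - w j) < e"
proof -
  interpret Metric_space "ncarrier (ell p)" "ndist (ell p)" by (rule Metric_space_ell[OF p])
  from z e obtain w where w: "w \<in> S" "w \<in> mball z e"
    unfolding ntopology_def metric_closure_of by blast
  then have *: "w \<in> ncarrier (ell p)" "z \<in> ncarrier (ell p)" "nnorm (ell p) (z - w) < e"
    by (auto simp: in_mball ndist_def)
  have "norm (z j - w j) < e"
    using norm_le_nnorm_ell[OF diff_ell[OF p *(2,1)] p, of j] *(3) by simp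
  with w show ?thesis using that by blast
qed

lemma continuous_map_ellI:
  assumes p: "1 \<le> p" "1 \<le> r"
    and F: "\<And>x. x \<in> ncarrier (ell p) \<Longrightarrow> F x \<in> ncarrier (ell r)"
    and c: "\<And>y e. y \<in> ncarrier (ell p) \<Longrightarrow> e > 0 \<Longrightarrow>
      \<exists>d>0. \<forall>x\<in>ncarrier (ell p). nnorm (ell p) (x - y) < d \<longrightarrow> nnorm (ell r) (F x - F y) < e"
  shows "continuous_map (ntopology (ell p)) (ntopology (ell r)) F"
proof -
  interpret Metric_space "ncarrier (ell p)" "ndist (ell p)" by (rule Metric_space_ell[OF p(1)])
  interpret R: Metric_space "ncarrier (ell r)" "ndist (ell r)" by (rule Metric_space_ell[OF p(2)])
  show ?thesis
    unfolding ntopology_def metric_continuous_map[OF R.Metric_space_axioms]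
  proof (intro conjI ballI allI impI)
    fix y and e :: real assume y: "y \<in> ncarrier (ell p)" and "e > 0"
    from c[OF this] obtain d where "d > 0"
      and d: "\<And>x. x \<in> ncarrier (ell p) \<Longrightarrow> nnorm (ell p) (x - y) < d \<Longrightarrow> nnorm (ell r) (F x - F y) < e"
      by blast
    show "\<exists>d>0. \<forall>x. x \<in> ncarrier (ell p) \<and> ndist (ell p) y x < d \<longrightarrow> ndist (ell r) (F y) (F x) < e"
      using \<open>d > 0\<close> d y F by (intro exI[of _ d]) (auto simp: nnorm_ell_minus_commute[of p y] nnorm_ell_minus_commute[of r "F y"] ndist_def)
  qed (use F in auto)
qed

section \<open>\<open>p\<close>-convex hulls\<close>

lemma sum_fun_apply: "(\<Sum>i\<in>A. f i) j = (\<Sum>i\<in>A. f i j)"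
  for f :: "'i \<Rightarrow> 'a \<Rightarrow> 'b::comm_monoid_add"
  by (induction A rule: infinite_finite_induct) simp_all

lemma mem_lp_ell:
  "y \<in> ncarrier (lp p (ell p)) \<longleftrightarrow>
    (\<forall>n. y n \<in> ncarrier (ell p)) \<and> summable (\<lambda>n. nnorm (ell p) (y n) powr p)"
  by (simp add: lp_def)

lemma nnorm_lp_ell:
  "nnorm (lp p (ell p)) y = (\<Sum>n. nnorm (ell p) (y n) powr p) powr (1 / p)"
  by (simp add: lp_def)

lemma nnorm_lp_ell_powr:
  assumes "y \<in> ncarrier (lp p (ell p))" "1 \<le> p"
  shows "nnorm (lp p (ell p)) y powr p = (\<Sum>n. nnorm (ell p) (y n) powr p)"
  using assms unfolding nnorm_lp_ell mem_lp_ell by (simp add: powr_powr suminf_nonneg)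

text \<open>This lets vectors of the l_1 ball, the domain of the function, serve directly as
  coefficient sequences of a p-convex hull, for all p including p = 1, where the conjugate space is
  l_infinity.\<close>

lemma unit_cball_ell_conj:
  assumes p: "1 \<le> p" and \<alpha>: "\<alpha> \<in> unit_cball (ell 1)"
  shows "\<alpha> \<in> unit_cball (ell_conj p)"
proof -
  have s: "summable (\<lambda>n. norm (\<alpha> n))" and le: "(\<Sum>n. norm (\<alpha> n)) \<le> 1"
    using \<alpha> by (auto simp: unit_cball_def mem_ell_1 nnorm_ell_1)
  have le1: "norm (\<alpha> n) \<le> 1" for n
    using sum_le_suminf[OF s, of "{n}"] le by simp
  show ?thesis
  proof (cases "p = 1")
    case True
    then show ?thesis
      using le1 by (auto simp: unit_cball_def ell_conj_def linf_def complex_nspace_def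
          intro!: cSUP_least bdd_aboveI2[of _ _ 1])
  next
    case False
    then have "1 \<le> p / (p - 1)" using p by (simp add: le_divide_eq)
    from ell_bound[OF this s, of \<alpha>] le False show ?thesis
      by (simp add: unit_cball_def ell_conj_def)
  qed
qed

text \<open>For p > 1 this is Young's inequality applied to the coefficients and to w/s. The scale s
  exceeds the p-norm of w by e, so that division by s is possible even when w is zero. The bound
  holds for all partial sums and hence for their limit.\<close>

lemma Hoelder_ell_conj:
  assumes p: "1 \<le> p" and \<alpha>: "\<alpha> \<in> unit_cball (ell_conj p)"
    and w: "summable (\<lambda>n. norm (w n :: complex) powr p)"
    and z: "(\<lambda>N. \<Sum>n<N. \<alpha> n * w n) \<longlonglongrightarrow> z"
  shows "norm z \<le> (\<Sum>n. norm (w n) powr p) powr (1 / p)"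
proof (rule field_le_epsilon)
  fix e :: real assume e: "e > 0"
  define W where "W = (\<Sum>n. norm (w n) powr p)"
  define s where "s = W powr (1 / p) + e"
  have W: "0 \<le> W" unfolding W_def by (intro suminf_nonneg w) simp
  have s: "s > 0" using e by (simp add: s_def add_nonneg_pos)
  have "(W powr (1/p)) powr p \<le> s powr p" using e p by (intro powr_mono2) (auto simp: s_def)
  then have Ws: "W \<le> s powr p" using W p by (simp add: powr_powr)
  have "norm (\<Sum>n<N. \<alpha> n * w n) \<le> s" for N
  proof (cases "p = 1")
    case True
    have \<alpha>1: "norm (\<alpha> n) \<le> 1" for n
    proof -
      have "norm (\<alpha> n) \<le> (SUP n. norm (\<alpha> n))"
        using \<alpha> True by (intro cSUP_upper) (auto simp: unit_cball_def ell_conj_def linf_def complex_nspace_def)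
      also have "\<dots> \<le> 1" using \<alpha> True by (simp add: unit_cball_def ell_conj_def linf_def complex_nspace_def)
      finally show ?thesis .
    qed
    have "norm (\<Sum>n<N. \<alpha> n * w n) \<le> (\<Sum>n<N. norm (w n))"
      by (rule sum_norm_le) (use \<alpha>1 in \<open>auto simp: norm_mult intro: mult_left_le_one_le\<close>)
    also have "\<dots> \<le> W" unfolding W_def using w True by (simp add: sum_le_suminf)
    also have "\<dots> \<le> s" using Ws s True by simp
    finally show ?thesis .
  next
    case False
    with p have p1: "p > 1" by simp
    define q where "q = p / (p - 1)"
    have q: "q > 1" "1/p + 1/q = 1" using p1 by (auto simp: q_def field_simps)
    have \<alpha>q: "\<alpha> \<in> ncarrier (ell q)" "nnorm (ell q) \<alpha> \<le> 1"
      using \<alpha> False by (auto simp: unit_cball_def ell_conj_def q_def)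
    have "(\<Sum>n. norm (\<alpha> n) powr q) \<le> 1 powr q"
      using \<alpha>q q powr_mono2[of q "nnorm (ell q) \<alpha>" 1] nnorm_ell_nonneg[of q \<alpha>]
      by (subst nnorm_ell_powr[symmetric]) auto
    then have A: "(\<Sum>n<N. norm (\<alpha> n) powr q) \<le> 1"
      using sum_le_suminf[of "\<lambda>n. norm (\<alpha> n) powr q" "{..<N}"] \<alpha>q(1) by (simp add: mem_ell)
    have B: "(\<Sum>n<N. (norm (w n) / s) powr p) \<le> 1"
    proof -
      have "(\<Sum>n<N. norm (w n) powr p) \<le> s powr p"
        using sum_le_suminf[OF w, of "{..<N}"] Ws by (simp add: W_def)
      then show ?thesis using s by (simp add: powr_divide divide_le_eq flip: sum_divide_distrib)
    qed
    have "norm (\<Sum>n<N. \<alpha> n * w n) \<le> (\<Sum>n<N. s * ((norm (w n) / s) powr p / p + norm (\<alpha> n) powr q / q))"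
    proof (rule sum_norm_le)
      fix n
      have "norm (\<alpha> n * w n) = s * (norm (w n) / s * norm (\<alpha> n))" using s by (simp add: norm_mult)
      also have "\<dots> \<le> s * ((norm (w n) / s) powr p / p + norm (\<alpha> n) powr q / q)"
        using s p1 q by (intro mult_left_mono Youngs_inequality) auto
      finally show "norm (\<alpha> n * w n) \<le> s * ((norm (w n) / s) powr p / p + norm (\<alpha> n) powr q / q)" .
    qed
    also have "\<dots> = s * ((\<Sum>n<N. (norm (w n) / s) powr p) / p + (\<Sum>n<N. norm (\<alpha> n) powr q) / q)"
      by (simp add: sum_divide_distrib sum.distrib flip: sum_distrib_left)
    also have "\<dots> \<le> s * (1 / p + 1 / q)"
      using s p1 q A B by (intro mult_left_mono add_mono divide_right_mono) auto
    finally show ?thesis using q by simp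
  qed
  then show "norm z \<le> (\<Sum>n. norm (w n) powr p) powr (1 / p) + e"
    unfolding W_def[symmetric] s_def[symmetric] by (intro Lim_norm_ubound[OF _ z]) auto
qed

text \<open>Hoelder's inequality bounds the j-th coordinate on the hull; coordinates are contractive
  on l_p, so the bound survives passage to the closure.\<close>

lemma norm_coord_closure_p_co:
  assumes p: "1 \<le> p" and y: "y \<in> ncarrier (lp p (ell p))"
    and z: "z \<in> ntopology (ell p) closure_of p_co p (ell p) y"
  shows "summable (\<lambda>n. norm (y n j) powr p)"
    and "norm (z j) powr p \<le> (\<Sum>n. norm (y n j) powr p)"
proof -
  have le: "norm (y n j) powr p \<le> nnorm (ell p) (y n) powr p" for n
    using y p by (intro powr_mono2 norm_le_nnorm_ell) (auto simp: mem_lp_ell)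
  have "summable (\<lambda>n. nnorm (ell p) (y n) powr p)" using y by (simp add: mem_lp_ell)
  then show s: "summable (\<lambda>n. norm (y n j) powr p)"
    by (rule summable_comparison_test'[of "\<lambda>n. nnorm (ell p) (y n) powr p" 0]) (simp add: le)
  let ?S = "\<Sum>n. norm (y n j) powr p"
  have "norm (z j) \<le> ?S powr (1/p)"
  proof (rule field_le_epsilon)
    fix e :: real assume "e > 0"
    from closure_of_ellD[OF p z this] obtain w
      where w: "w \<in> p_co p (ell p) y" "norm (z j - w j) < e" by blast
    then obtain \<alpha> where \<alpha>: "\<alpha> \<in> unit_cball (ell_conj p)"
      and lim: "limitin (ntopology (ell p)) (\<lambda>N. \<Sum>n<N. \<alpha> n *\<^sub>C y n) w sequentially"
      by (auto simp: p_co_def)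
    have "(\<lambda>N. \<Sum>n<N. \<alpha> n * y n j) \<longlonglongrightarrow> w j"
      using limitin_ell_coord[OF p lim, of j] by (simp add: sum_fun_apply scaleC_fun_def scaleC_complex_def)
    from Hoelder_ell_conj[OF p \<alpha> s this] w(2) norm_triangle_ineq2[of "z j" "w j"]
    show "norm (z j) \<le> ?S powr (1/p) + e" by linarith
  qed
  then have "norm (z j) powr p \<le> (?S powr (1/p)) powr p" using p by (intro powr_mono2) auto
  then show "norm (z j) powr p \<le> ?S" using p suminf_nonneg[OF s] by (simp add: powr_powr)
qed

text \<open>
  Every lower bound rests on this lemma: if \<open>K\<close> lies in the closure of \<open>p-co{y\<^sub>n}\<close>, then by Hoelder's
  inequality the \<open>j\<close>-th coordinates of \<open>K\<close> are bounded by the \<open>p\<close>-norm of \<open>(y\<^sub>n(j))\<^sub>n\<close>.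
\<close>

lemma sum_coord_le_nnorm_lp:
  assumes p: "1 \<le> p" and y: "y \<in> ncarrier (lp p (ell p))"
    and K: "K \<subseteq> ntopology (ell p) closure_of p_co p (ell p) y"
    and J: "finite J" and c: "\<And>j. j \<in> J \<Longrightarrow> 0 \<le> c j \<and> (\<exists>z\<in>K. c j \<le> norm (z j))"
  shows "(\<Sum>j\<in>J. c j powr p) \<le> nnorm (lp p (ell p)) y powr p"
proof -
  have sj: "summable (\<lambda>n. norm (y n j) powr p)" and cj: "c j powr p \<le> (\<Sum>n. norm (y n j) powr p)"
    if j: "j \<in> J" for j
  proof -
    from c[OF j] obtain z where z: "z \<in> K" "c j \<le> norm (z j)" "0 \<le> c j" by blast
    with K have *: "z \<in> ntopology (ell p) closure_of p_co p (ell p) y" by blast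
    show "summable (\<lambda>n. norm (y n j) powr p)" by (rule norm_coord_closure_p_co(1)[OF p y *])
    have "c j powr p \<le> norm (z j) powr p" using z p by (intro powr_mono2) auto
    with norm_coord_closure_p_co(2)[OF p y *, of j]
    show "c j powr p \<le> (\<Sum>n. norm (y n j) powr p)" by linarith
  qed
  have yn: "y n \<in> ncarrier (ell p)" for n using y by (simp add: mem_lp_ell)
  \<comment> \<open>The point of K that realises \<open>c j\<close> may change with j, yet the same
    sequence y bounds all these coordinates. After the sums are exchanged, each y n pays for all j
    in J at once through its own l_p norm. So K can be expensive although all its points are
    small.\<close>
  have "(\<Sum>j\<in>J. c j powr p) \<le> (\<Sum>j\<in>J. \<Sum>n. norm (y n j) powr p)" by (rule sum_mono) (rule cj)
  also have "\<dots> = (\<Sum>n. \<Sum>j\<in>J. norm (y n j) powr p)" by (rule suminf_sum[symmetric]) (rule sj)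
  also have "\<dots> \<le> (\<Sum>n. nnorm (ell p) (y n) powr p)"
  proof (rule suminf_le)
    show "(\<Sum>j\<in>J. norm (y n j) powr p) \<le> nnorm (ell p) (y n) powr p" for n
      using yn[of n] p J by (simp add: nnorm_ell_powr mem_ell sum_le_suminf)
    show "summable (\<lambda>n. \<Sum>j\<in>J. norm (y n j) powr p)" by (rule summable_sum) (rule sj)
    show "summable (\<lambda>n. nnorm (ell p) (y n) powr p)" using y by (simp add: mem_lp_ell)
  qed
  also have "\<dots> = nnorm (lp p (ell p)) y powr p" by (rule nnorm_lp_ell_powr[OF y p, symmetric])
  finally show ?thesis .
qed

lemma p_co_subset_closure:
  "p_co p (ell p) y \<subseteq> ntopology (ell p) closure_of p_co p (ell p) y"
  by (rule closure_of_subset) (auto simp: p_co_def dest: limitin_topspace)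

definition diag_seq :: "(nat \<Rightarrow> complex) \<Rightarrow> nat \<Rightarrow> nat \<Rightarrow> complex"
  where "diag_seq b n = b n *\<^sub>C unit_seq n"

lemma diag_seq_apply: "diag_seq b n j = (if j = n then b n else 0)"
  by (simp add: diag_seq_def scaleC_fun_def scaleC_complex_def unit_seq_def)

lemma diag_seq_lp:
  assumes p: "1 \<le> p" and b: "summable (\<lambda>n. norm (b n) powr p)"
  shows "diag_seq b \<in> ncarrier (lp p (ell p))"
    and "nnorm (lp p (ell p)) (diag_seq b) = (\<Sum>n. norm (b n) powr p) powr (1 / p)"
proof -
  have *: "(\<lambda>j. norm (diag_seq b n j) powr p) = (\<lambda>j. if j = n then norm (b n) powr p else 0)" for n
    by (auto simp: diag_seq_apply fun_eq_iff)
  have mem: "diag_seq b n \<in> ncarrier (ell p)" for n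
    unfolding mem_ell * by (rule sums_summable[OF sums_single])
  moreover have "nnorm (ell p) (diag_seq b n) powr p = norm (b n) powr p" for n
    unfolding nnorm_ell_powr[OF mem p] * by (rule sums_unique[OF sums_single, symmetric])
  ultimately show "diag_seq b \<in> ncarrier (lp p (ell p))"
    and "nnorm (lp p (ell p)) (diag_seq b) = (\<Sum>n. norm (b n) powr p) powr (1 / p)"
    using b by (simp_all add: mem_lp_ell nnorm_lp_ell)
qed

text \<open>The tool for all upper bounds: a diagonal map sends the l_1 ball into the p-convex hull
  of its scaled unit vectors. Since \<alpha> is summable and b bounded, the error of the partial
  sums is dominated by the tail of an l_1 series.\<close>

lemma mult_mem_p_co_diag_seq:
  assumes p: "1 \<le> p" and b: "summable (\<lambda>n. norm (b n) powr p)" and \<alpha>: "\<alpha> \<in> unit_cball (ell 1)"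
  shows "(\<lambda>n. \<alpha> n * b n) \<in> p_co p (ell p) (diag_seq b)"
proof -
  define B where "B = nnorm (ell p) b"
  have B: "norm (b n) \<le> B" for n
    unfolding B_def using b p by (intro norm_le_nnorm_ell) (auto simp: mem_ell)
  let ?z = "\<lambda>n. \<alpha> n * b n"
  let ?s = "\<lambda>N. \<Sum>n<N. \<alpha> n *\<^sub>C diag_seq b n"
  have "summable (\<lambda>n. norm (\<alpha> n))" using \<alpha> by (simp add: unit_cball_def mem_ell_1)
  then have "summable (\<lambda>n. norm (\<alpha> n) * B)" by (rule summable_mult2)
  then have sz: "summable (\<lambda>n. norm (?z n))"
    by (rule summable_comparison_test'[of _ 0]) (auto simp: norm_mult intro!: mult_left_mono B)
  have s: "?s N j = (if j < N then ?z j else 0)" for N j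
  proof -
    have "?s N j = (\<Sum>n<N. if n = j then \<alpha> j * b j else 0)"
      unfolding sum_fun_apply by (intro sum.cong) (auto simp: scaleC_fun_def scaleC_complex_def diag_seq_apply)
    then show ?thesis by simp
  qed
  let ?g = "\<lambda>N j. norm (?z j) - (if j < N then norm (?z j) else 0)"
  have fin: "(\<lambda>j. if j < N then norm (?z j) else 0) sums (\<Sum>j<N. norm (?z j))" for N
    using sums_If_finite_set[of "{..<N}" "\<lambda>j. norm (?z j)"] by simp
  have g: "?g N sums ((\<Sum>j. norm (?z j)) - (\<Sum>j<N. norm (?z j)))" for N
    by (intro sums_diff fin summable_sums sz)
  have gz: "norm (?z j) \<le> norm (?z j)" for j by simp
  have sN: "?s N \<in> ncarrier (ell p)" for N
    by (rule ell_bound(1)[OF p sums_summable[OF fin[of N]]]) (simp add: s)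
  have bd: "nnorm (ell p) (?s N - ?z) \<le> (\<Sum>j. norm (?z j)) - (\<Sum>j<N. norm (?z j))" for N
    unfolding sums_unique[OF g] by (rule ell_bound(2)[OF p sums_summable[OF g]]) (simp add: s norm_minus_commute)
  have "(\<lambda>N. (\<Sum>j. norm (?z j)) - (\<Sum>j<N. norm (?z j))) \<longlonglongrightarrow> (\<Sum>j. norm (?z j)) - (\<Sum>j. norm (?z j))"
    by (intro tendsto_diff tendsto_const summable_LIMSEQ sz)
  then have "(\<lambda>N. (\<Sum>j. norm (?z j)) - (\<Sum>j<N. norm (?z j))) \<longlonglongrightarrow> 0" by simp
  then have "(\<lambda>N. nnorm (ell p) (?s N - ?z)) \<longlonglongrightarrow> 0"
    by (rule tendsto_sandwich[OF _ _ tendsto_const, rotated 2]) (simp_all add: nnorm_ell_nonneg bd)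
  then have "limitin (ntopology (ell p)) ?s ?z sequentially"
    by (rule limitin_ellI[OF p ell_bound(1)[OF p sz gz] sN])
  then show ?thesis unfolding p_co_def using unit_cball_ell_conj[OF p \<alpha>] by blast
qed

section \<open>Homogeneous polynomials and Taylor expansions\<close>

lemma cont_hom_poly_mem:
  assumes "cont_hom_poly E F m P" "x \<in> ncarrier E"
  shows "P x \<in> ncarrier F"
proof -
  from assms obtain A where A: "multilinear_on E F m A" "P x = A (replicate m x)"
    by (auto simp: cont_hom_poly_def)
  moreover have "length (replicate m x) = m \<and> set (replicate m x) \<subseteq> ncarrier E"
    using assms(2) by auto
  ultimately show ?thesis unfolding multilinear_on_def by metis
qed

lemma cont_hom_poly_scaleC:
  assumes P: "cont_hom_poly E F m P" and x: "x \<in> ncarrier E" "t *\<^sub>C x \<in> ncarrier E"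
  shows "P (t *\<^sub>C x) = t ^ m *\<^sub>C P x"
proof -
  from P x obtain A where A: "multilinear_on E F m A"
    and Px: "P x = A (replicate m x)" "P (t *\<^sub>C x) = A (replicate m (t *\<^sub>C x))"
    by (auto simp: cont_hom_poly_def)
  have "A (replicate i (t *\<^sub>C x) @ replicate (m - i) x) = t ^ i *\<^sub>C A (replicate m x)" if "i \<le> m" for i
    using that
  proof (induction i)
    case 0
    then show ?case by (simp add: scaleC_one)
  next
    case (Suc i)
    define xs where "xs = replicate i (t *\<^sub>C x) @ replicate (m - i) x"
    have m: "m - i = Suc (m - Suc i)" using Suc.prems by simp
    have "length xs = m" "set xs \<subseteq> ncarrier E" using Suc.prems x by (auto simp: xs_def)
    with A Suc.prems x have "A (xs[i := t *\<^sub>C x]) = t *\<^sub>C A (xs[i := x])"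
      unfolding multilinear_on_def by (metis Suc_le_lessD)
    moreover have "xs[i := x] = xs" "xs[i := t *\<^sub>C x] = replicate (Suc i) (t *\<^sub>C x) @ replicate (m - Suc i) x"
      unfolding xs_def m by (simp_all add: list_update_append replicate_app_Cons_same)
    ultimately show ?case using Suc by (simp add: xs_def scaleC_scaleC)
  qed
  from this[of m] Px show ?thesis by simp
qed

lemma zero_mem_ell [simp]: "0 \<in> ncarrier (ell p)"
  by (simp add: mem_ell)

lemma sum_mem_ell:
  assumes "1 \<le> p" "\<And>i. i \<in> I \<Longrightarrow> f i \<in> ncarrier (ell p)"
  shows "(\<Sum>i\<in>I. f i) \<in> ncarrier (ell p)"
  using assms(2)
  by (induction I rule: infinite_finite_induct) (simp_all add: add_ell(1)[OF assms(1)])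

text \<open>Restricting to the complex line through y in direction x, and to one coordinate of the
  target, turns the expansion into a scalar power series. Its guaranteed disc shrinks with the norm
  of x because only some neighbourhood of y is available.\<close>

lemma has_taylor_expansion_coord_sums:
  assumes pq: "1 \<le> p" "1 \<le> q"
    and f: "f \<in> ncarrier (ell p) \<rightarrow> ncarrier (ell q)"
    and P: "has_taylor_expansion (ell p) (ell q) f y P"
    and x: "x \<in> ncarrier (ell p)"
  shows "\<exists>s>0. \<forall>t. norm t < s \<longrightarrow> (\<lambda>m. P m x j * t ^ m) sums f (y + t *\<^sub>C x) j"
proof -
  from P obtain V where hom: "\<And>m. cont_hom_poly (ell p) (ell q) m (P m)"
    and V: "openin (ntopology (ell p)) V" "y \<in> V"
    and lim: "uniform_limit V (\<lambda>n x. nnorm (ell q) (f x - (\<Sum>m<n. P m (x - y)))) (\<lambda>_. 0) sequentially"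
    by (auto simp: has_taylor_expansion_def)
  from openin_ellD[OF pq(1) V] obtain r where r: "r > 0" and y: "y \<in> ncarrier (ell p)"
    and rV: "\<And>x. x \<in> ncarrier (ell p) \<Longrightarrow> nnorm (ell p) (x - y) < r \<Longrightarrow> x \<in> V" by blast
  define s where "s = r / (nnorm (ell p) x + 1)"
  have pos: "nnorm (ell p) x + 1 > 0" using nnorm_ell_nonneg[of p x] by linarith
  show ?thesis
  proof (intro exI[of _ s] conjI allI impI)
    show "s > 0" using r pos by (simp add: s_def)
    fix t :: complex assume t: "norm t < s"
    have tx: "t *\<^sub>C x \<in> ncarrier (ell p)" and n: "nnorm (ell p) (t *\<^sub>C x) = norm t * nnorm (ell p) x"
      using scaleC_ell[OF x pq(1)] by blast+
    have "norm t * nnorm (ell p) x \<le> norm t * (nnorm (ell p) x + 1)" by (intro mult_left_mono) auto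
    also have "\<dots> < r" using t pos by (simp add: s_def less_divide_eq)
    finally have "nnorm (ell p) (y + t *\<^sub>C x - y) < r" by (simp add: n)
    moreover have ytx: "y + t *\<^sub>C x \<in> ncarrier (ell p)" by (rule add_ell(1)[OF pq(1) y tx])
    ultimately have "y + t *\<^sub>C x \<in> V" by (intro rV)
    from tendsto_uniform_limitI[OF lim this]
    have lim': "(\<lambda>n. nnorm (ell q) (f (y + t *\<^sub>C x) - (\<Sum>m<n. P m (t *\<^sub>C x)))) \<longlonglongrightarrow> 0" by simp
    have "(\<lambda>n. f (y + t *\<^sub>C x) j - (\<Sum>m<n. P m x j * t ^ m)) \<longlonglongrightarrow> 0"
    proof (rule tendsto_norm_zero_cancel, rule tendsto_sandwich[OF _ _ tendsto_const lim'])
      show "\<forall>\<^sub>F n in sequentially. norm (f (y + t *\<^sub>C x) j - (\<Sum>m<n. P m x j * t ^ m))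
          \<le> nnorm (ell q) (f (y + t *\<^sub>C x) - (\<Sum>m<n. P m (t *\<^sub>C x)))"
      proof (rule always_eventually, rule allI)
        fix n
        have "f (y + t *\<^sub>C x) - (\<Sum>m<n. P m (t *\<^sub>C x)) \<in> ncarrier (ell q)"
          using f ytx by (intro diff_ell[OF pq(2)] sum_mem_ell[OF pq(2)] cont_hom_poly_mem[OF hom tx]) auto
        moreover have "P m (t *\<^sub>C x) j = P m x j * t ^ m" for m
          by (simp add: cont_hom_poly_scaleC[OF hom x tx]) (simp add: scaleC_fun_def scaleC_complex_def)
        ultimately
        show "norm (f (y + t *\<^sub>C x) j - (\<Sum>m<n. P m x j * t ^ m))
          \<le> nnorm (ell q) (f (y + t *\<^sub>C x) - (\<Sum>m<n. P m (t *\<^sub>C x)))"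
          using norm_le_nnorm_ell[of "f (y + t *\<^sub>C x) - (\<Sum>m<n. P m (t *\<^sub>C x))" q j] pq(2)
          by (simp add: sum_fun_apply)
      qed
    qed simp
    from tendsto_diff[OF tendsto_const[of "f (y + t *\<^sub>C x) j"] this]
    show "(\<lambda>m. P m x j * t ^ m) sums f (y + t *\<^sub>C x) j" by (simp add: sums_def)
  qed
qed

text \<open>Convergence at the positive reals below s gives a positive radius of convergence, so the
  identity theorem for formal power series applies.\<close>

lemma powser_coeffs_unique:
  fixes a b :: "nat \<Rightarrow> complex"
  assumes "s > 0" "\<And>t. norm t < s \<Longrightarrow> (\<lambda>m. a m * t ^ m) sums g t"
    "\<And>t. norm t < s \<Longrightarrow> (\<lambda>m. b m * t ^ m) sums g t"
  shows "a = b"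
proof -
  have rad: "fps_conv_radius (Abs_fps c) > 0"
    if "\<And>t. norm t < s \<Longrightarrow> (\<lambda>m. c m * t ^ m) sums g t" for c
  proof -
    have "conv_radius c \<ge> ereal s"
    proof (rule conv_radius_geI_ex)
      fix r :: real assume "0 < r" "ereal r < ereal s"
      then have "summable (\<lambda>m. c m * of_real r ^ m)" by (intro sums_summable[OF that]) simp
      with \<open>0 < r\<close> show "\<exists>z. norm z = r \<and> summable (\<lambda>n. c n * z ^ n)"
        by (intro exI[of _ "of_real r"]) simp
    qed
    then show ?thesis using assms(1) by (simp add: fps_conv_radius_def) (meson ereal_less(2) less_le_trans)
  qed
  have "eventually (\<lambda>z. eval_fps (Abs_fps a) z = eval_fps (Abs_fps b) z) (nhds 0)"
    unfolding eventually_nhds_metric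
    using assms by (intro exI[of _ s]) (auto simp: eval_fps_def sums_iff)
  with rad[OF assms(2)] rad[OF assms(3)] have "Abs_fps a = Abs_fps b" by (intro eval_fps_eqD)
  then show ?thesis by (simp add: Abs_fps_inject)
qed

text \<open>This is what makes the choice in \<open>taylor_poly\<close> computable: on the carrier
  it agrees with any expansion that can be exhibited.\<close>

lemma has_taylor_expansion_unique:
  assumes pq: "1 \<le> p" "1 \<le> q"
    and f: "f \<in> ncarrier (ell p) \<rightarrow> ncarrier (ell q)"
    and P: "has_taylor_expansion (ell p) (ell q) f y P"
    and Q: "has_taylor_expansion (ell p) (ell q) f y Q"
    and x: "x \<in> ncarrier (ell p)"
  shows "P m x = Q m x"
proof
  fix j
  obtain s where s: "s > 0" "\<And>t. norm t < s \<Longrightarrow> (\<lambda>m. P m x j * t ^ m) sums f (y + t *\<^sub>C x) j"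
    using has_taylor_expansion_coord_sums[OF pq f P x, of j] by blast
  obtain s' where s': "s' > 0" "\<And>t. norm t < s' \<Longrightarrow> (\<lambda>m. Q m x j * t ^ m) sums f (y + t *\<^sub>C x) j"
    using has_taylor_expansion_coord_sums[OF pq f Q x, of j] by blast
  have "(\<lambda>m. P m x j) = (\<lambda>m. Q m x j)"
    by (rule powser_coeffs_unique[of "min s s'" _ "\<lambda>t. f (y + t *\<^sub>C x) j"]) (use s s' in auto)
  then show "P m x j = Q m x j" by (rule fun_cong)
qed

section \<open>Shifted sequences and the shape shared by the Taylor polynomials\<close>

lemma summable_Suc_ell_1: "x \<in> ncarrier (ell 1) \<Longrightarrow> summable (\<lambda>j. norm (x (Suc j)))"
  using summable_Suc_iff[of "\<lambda>j. norm (x j)"] by (simp add: mem_ell_1)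

lemma suminf_Suc_le_nnorm_ell_1:
  assumes "x \<in> ncarrier (ell 1)"
  shows "(\<Sum>j. norm (x (Suc j))) \<le> nnorm (ell 1) x"
  using suminf_split_head[of "\<lambda>j. norm (x j)"] assms by (simp add: mem_ell_1 nnorm_ell_1)

lemma cont_hom_poly_const:
  assumes "1 \<le> p" "1 \<le> q" "c \<in> ncarrier (ell q)"
  shows "cont_hom_poly (ell p) (ell q) 0 (\<lambda>_. c)"
  unfolding cont_hom_poly_def
proof
  show "\<exists>A. multilinear_on (ell p) (ell q) 0 A \<and> (\<forall>x\<in>ncarrier (ell p). c = A (replicate 0 x))"
    using assms(3) by (intro exI[of _ "\<lambda>_. c"]) (simp add: multilinear_on_def)
  show "continuous_map (ntopology (ell p)) (ntopology (ell q)) (\<lambda>_. c)"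
    using assms by (simp add: topspace_ell)
qed

text \<open>Every Taylor polynomial of positive degree of the function has this shape: a power of
  h_0 times a linear map into l_p. The multilinear map \<open>A\<close> puts the linear map in slot
  0 and the functional h_0 in slots 1 to k; it is not symmetrised.\<close>

lemma cont_hom_poly_power_mult_linear:
  fixes u b :: "nat \<Rightarrow> complex"
  assumes p: "1 \<le> p" and u: "u \<in> ncarrier (ell 1)" and b: "\<And>j. norm (b j) \<le> B"
  shows "cont_hom_poly (ell 1) (ell p) (Suc k) (\<lambda>h j. h 0 ^ k * (h 0 * u j + b j * h (Suc j)))"
    (is "cont_hom_poly _ _ _ ?F")
  unfolding cont_hom_poly_def
proof
  have B: "0 \<le> B" using b[of 0] norm_ge_zero[of "b 0"] by linarith
  have su: "summable (\<lambda>j. norm (u j))" using u by (simp add: mem_ell_1)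
  define T where "T h j = h 0 * u j + b j * h (Suc j)" for h j
  have T: "(\<lambda>j. c * T h j) \<in> ncarrier (ell p)" if h: "h \<in> ncarrier (ell 1)" for c h
  proof (rule ell_bound(1)[OF p])
    show "summable (\<lambda>j. norm c * (norm (h 0) * norm (u j) + B * norm (h (Suc j))))"
      by (intro summable_mult summable_add su summable_Suc_ell_1 h)
    show "norm (c * T h j) \<le> norm c * (norm (h 0) * norm (u j) + B * norm (h (Suc j)))" for j
      unfolding T_def norm_mult
      by (intro mult_left_mono order_trans[OF norm_triangle_ineq] add_mono) (auto simp: norm_mult intro!: mult_right_mono b)
  qed
  define A where "A xs j = (\<Prod>i=1..k. (xs ! i) 0) * T (xs ! 0) j" for xs j
  show "\<exists>A. multilinear_on (ell 1) (ell p) (Suc k) A \<and> (\<forall>x\<in>ncarrier (ell 1). ?F x = A (replicate (Suc k) x))"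
  proof (intro exI[of _ A] conjI ballI)
    fix x :: "nat \<Rightarrow> complex"
    have "(\<Prod>i=1..k. (replicate (Suc k) x ! i) 0) = (\<Prod>i=1..k. x 0)"
      by (intro prod.cong) (simp_all del: replicate_Suc)
    then show "?F x = A (replicate (Suc k) x)"
      by (simp add: A_def T_def fun_eq_iff del: replicate_Suc)
  next
    show "multilinear_on (ell 1) (ell p) (Suc k) A"
      unfolding multilinear_on_def
    proof (intro allI impI conjI ballI)
      fix xs assume xs: "length xs = Suc k \<and> set xs \<subseteq> ncarrier (ell 1)"
      then have "xs ! 0 \<in> ncarrier (ell 1)" by (metis nth_mem subsetD zero_less_Suc)
      from T[OF this] show "A xs \<in> ncarrier (ell p)" by (simp add: A_def[abs_def])
      fix i x y c assume i: "i < Suc k"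
      have upd: "A (xs[i := z]) = (\<lambda>j. if i = 0 then (\<Prod>l=1..k. (xs ! l) 0) * T z j
          else z 0 * (\<Prod>l\<in>{1..k}-{i}. (xs ! l) 0) * T (xs ! 0) j)" for z
      proof (cases "i = 0")
        case True
        have "(\<Prod>l=1..k. (xs[i := z] ! l) 0) = (\<Prod>l=1..k. (xs ! l) 0)"
          by (intro prod.cong) (auto simp: True)
        then show ?thesis using True xs by (simp add: A_def fun_eq_iff)
      next
        case False
        then have "(\<Prod>l=1..k. (xs[i := z] ! l) 0) = (xs[i := z] ! i) 0 * (\<Prod>l\<in>{1..k}-{i}. (xs[i := z] ! l) 0)"
          using i by (intro prod.remove) auto
        also have "(\<Prod>l\<in>{1..k}-{i}. (xs[i := z] ! l) 0) = (\<Prod>l\<in>{1..k}-{i}. (xs ! l) 0)"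
          by (intro prod.cong) auto
        finally show ?thesis using False xs i by (simp add: A_def fun_eq_iff)
      qed
      show "A (xs[i := x + y]) = A (xs[i := x]) + A (xs[i := y])"
        unfolding upd by (auto simp: T_def fun_eq_iff algebra_simps)
      show "A (xs[i := c *\<^sub>C x]) = c *\<^sub>C A (xs[i := x])"
        unfolding upd by (auto simp: T_def fun_eq_iff algebra_simps scaleC_fun_def scaleC_complex_def)
    qed
  qed
  show "continuous_map (ntopology (ell 1)) (ntopology (ell p)) ?F"
  proof (rule continuous_map_ellI)
    show "?F x \<in> ncarrier (ell p)" if "x \<in> ncarrier (ell 1)" for x
      using T[OF that] by (simp add: T_def[abs_def])
    fix y :: "nat \<Rightarrow> complex" and e :: real assume y: "y \<in> ncarrier (ell 1)" and e: "e > 0"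
    define U where "U = (\<Sum>j. norm (u j))"
    define Y where "Y = (\<Sum>j. norm (y (Suc j)))"
    \<comment> \<open>\<open>G\<close> majorises the variation of the polynomial: its first argument
      is x_0, its second stands for the distance r from x to y. It is continuous and vanishes at
      (y_0, 0). Both components of (x_0, r) differ from (y_0, 0) by at most r, hence the radius d/2
      below.\<close>
    define G where "G = (\<lambda>z::complex \<times> real. norm (fst z ^ Suc k - y 0 ^ Suc k) * U
        + norm (fst z) ^ k * B * snd z + norm (fst z ^ k - y 0 ^ k) * B * Y)"
    have "isCont G (y 0, 0)" unfolding G_def by (intro continuous_intros)
    moreover have "G (y 0, 0) = 0" by (simp add: G_def)
    ultimately obtain d where d: "d > 0" "\<And>z. dist z (y 0, 0) < d \<Longrightarrow> \<bar>G z\<bar> < e"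
      using e unfolding continuous_at_eps_delta by (auto simp: dist_real_def)
    have "nnorm (ell p) (?F x - ?F y) < e"
      if x: "x \<in> ncarrier (ell 1)" and xy: "nnorm (ell 1) (x - y) < d / 2" for x
    proof -
      define r where "r = nnorm (ell 1) (x - y)"
      have xmy: "x - y \<in> ncarrier (ell 1)" by (rule diff_ell[OF _ x y]) simp
      let ?g = "\<lambda>j. norm (x 0 ^ Suc k - y 0 ^ Suc k) * norm (u j)
        + norm (x 0) ^ k * B * norm ((x - y) (Suc j)) + norm (x 0 ^ k - y 0 ^ k) * B * norm (y (Suc j))"
      have sg: "summable ?g" by (intro summable_add summable_mult su summable_Suc_ell_1 xmy y)
      have "norm ((?F x - ?F y) j) \<le> ?g j" for j
      proof -
        have "(?F x - ?F y) j = (x 0 ^ Suc k - y 0 ^ Suc k) * u j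
            + x 0 ^ k * (b j * (x - y) (Suc j)) + (x 0 ^ k - y 0 ^ k) * (b j * y (Suc j))"
          by (simp add: algebra_simps)
        also have "norm \<dots> \<le> ?g j"
          unfolding mult.assoc
          by (intro order_trans[OF norm_triangle_ineq] add_mono)
            (auto simp: norm_mult norm_power intro!: mult_left_mono mult_right_mono b)
        finally show ?thesis .
      qed
      from ell_bound(2)[OF p sg, of "?F x - ?F y", OF this]
      have "nnorm (ell p) (?F x - ?F y) \<le> suminf ?g" .
      also have "\<dots> = norm (x 0 ^ Suc k - y 0 ^ Suc k) * U
          + norm (x 0) ^ k * B * (\<Sum>j. norm ((x - y) (Suc j))) + norm (x 0 ^ k - y 0 ^ k) * B * Y"
        unfolding U_def Y_def
        using su summable_Suc_ell_1[OF xmy] summable_Suc_ell_1[OF y]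
        by (simp add: suminf_add[symmetric] suminf_mult summable_add summable_mult)
      also have "\<dots> \<le> G (x 0, r)"
        unfolding G_def r_def fst_conv snd_conv
        by (intro add_mono mult_left_mono suminf_Suc_le_nnorm_ell_1 xmy) (auto simp: B)
      also have "\<dots> < e"
      proof -
        have "norm (x 0 - y 0) \<le> r" using norm_le_nnorm_ell[OF xmy, of 0] by (simp add: r_def)
        moreover have "dist (x 0, r) (y 0, 0) \<le> norm (x 0 - y 0) + \<bar>r\<bar>"
          unfolding dist_Pair_Pair using sqrt_sum_squares_le_sum_abs[of "dist (x 0) (y 0)" "dist r 0"]
          by (simp add: dist_norm)
        moreover have "0 \<le> r" unfolding r_def by (rule nnorm_ell_nonneg)
        ultimately have "dist (x 0, r) (y 0, 0) < d" using xy unfolding r_def by linarith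
        from d(2)[OF this] show ?thesis by linarith
      qed
      finally show ?thesis .
    qed
    then show "\<exists>d>0. \<forall>x\<in>ncarrier (ell 1). nnorm (ell 1) (x - y) < d \<longrightarrow> nnorm (ell p) (?F x - ?F y) < e"
      using d(1) by (intro exI[of _ "d / 2"]) simp
  qed (use p in auto)
qed

text \<open>Enumerate the disjoint union of the sets {..<g m} and let d j be the index of the piece
  containing the j-th element. Positivity of g makes the union infinite, so the enumeration is a
  bijection with the naturals. The blocks need not be intervals.\<close>

lemma ex_fibres_card:
  fixes g :: "nat \<Rightarrow> nat"
  assumes "\<And>m. 0 < g m"
  shows "\<exists>d::nat \<Rightarrow> nat. \<forall>m. card {j. d j = m} = g m"
proof -
  define S where "S = (SIGMA m:UNIV. {..<g m})"
  have "range (\<lambda>m. (m, 0)) \<subseteq> S" using assms by (auto simp: S_def)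
  moreover have "infinite (range (\<lambda>m::nat. (m, 0::nat)))" by (intro range_inj_infinite injI) simp
  ultimately have "infinite S" using infinite_super by blast
  then have bij: "bij_betw (from_nat_into S) UNIV S" by (intro bij_betw_from_nat_into) auto
  have "card {j. fst (from_nat_into S j) = m} = g m" for m
  proof -
    have "bij_betw (from_nat_into S) {j. fst (from_nat_into S j) = m} ({m} \<times> {..<g m})"
    proof (rule bij_betw_subset[OF bij])
      show "from_nat_into S ` {j. fst (from_nat_into S j) = m} = {m} \<times> {..<g m}"
      proof (intro equalityI subsetI)
        fix x assume "x \<in> from_nat_into S ` {j. fst (from_nat_into S j) = m}"
        then have "x \<in> S" "fst x = m" using bij by (auto simp: bij_betw_def)
        then show "x \<in> {m} \<times> {..<g m}" by (auto simp: S_def)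
      next
        fix x assume "x \<in> {m} \<times> {..<g m}"
        then have "x \<in> S" "fst x = m" by (auto simp: S_def)
        moreover obtain j where "from_nat_into S j = x"
          using \<open>x \<in> S\<close> bij by (metis bij_betw_imp_surj_on imageE)
        ultimately show "x \<in> from_nat_into S ` {j. fst (from_nat_into S j) = m}"
          by (intro image_eqI[of _ _ j]) auto
      qed
    qed simp
    then show ?thesis by (simp add: bij_betw_same_card)
  qed
  then show ?thesis by (intro exI[of _ "\<lambda>j. fst (from_nat_into S j)"]) blast
qed

section \<open>The counterexample\<close>

text \<open>The tail is majorised by the full binomial sum of the moduli. For n > m the expansion is
  already complete and nothing remains.\<close>

lemma norm_binomial_tail_le:
  fixes c t :: complex
  shows "norm ((c + t) ^ m - (\<Sum>i<n. of_nat (m choose i) * t ^ i * c ^ (m - i)))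
    \<le> (if n \<le> m then (norm c + norm t) ^ m else 0)"
proof -
  let ?b = "\<lambda>i. of_nat (m choose i) * t ^ i * c ^ (m - i)"
  have bin: "(c + t) ^ m = (\<Sum>i\<le>m. ?b i)" by (subst add.commute) (rule binomial_ring)
  show ?thesis
  proof (cases "n \<le> m")
    case True
    then have "{..m} = {..<n} \<union> {n..m}" by auto
    then have "(\<Sum>i\<le>m. ?b i) = (\<Sum>i<n. ?b i) + (\<Sum>i=n..m. ?b i)"
      by (simp only:) (rule sum.union_disjoint, auto)
    then have "norm ((c + t) ^ m - (\<Sum>i<n. ?b i)) = norm (\<Sum>i=n..m. ?b i)" by (simp add: bin)
    also have "\<dots> \<le> (\<Sum>i=n..m. of_nat (m choose i) * norm t ^ i * norm c ^ (m - i))"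
      by (rule sum_norm_le) (simp add: norm_mult norm_power)
    also have "\<dots> \<le> (\<Sum>i\<le>m. of_nat (m choose i) * norm t ^ i * norm c ^ (m - i))"
      by (rule sum_mono2) auto
    also have "\<dots> = (norm c + norm t) ^ m" by (subst add.commute) (rule binomial_ring[symmetric])
    finally show ?thesis using True by simp
  next
    case False
    have "(\<Sum>i<n. ?b i) = (\<Sum>i\<le>m. ?b i)"
      using False by (intro sum.mono_neutral_right) auto
    then show ?thesis using False by (simp add: bin)
  qed
qed

locale weighted_blocks =
  fixes p :: real and d :: "nat \<Rightarrow> nat" and w :: "nat \<Rightarrow> real"
  assumes p: "1 \<le> p"
    and w_pos: "\<And>m. 0 < w m"
    and block_mass: "\<And>m. real (card {j. d j = m}) * w m powr p = 1"
    \<comment> \<open>makes the function defined below entire: its degree in the coordinate \<open>x\<^sub>0\<close> is unbounded\<close>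
    and w_rapid: "\<And>R. (\<lambda>m. w m * R ^ m) \<longlonglongrightarrow> 0"
begin

lemma finite_block: "finite {j. d j = m}"
  using block_mass[of m] by (intro card_ge_0_finite) (auto intro: Nat.gr0I)

text \<open>By \<open>block_mass\<close> the numbers w(d j)^p form a probability weight on each
  block.\<close>

lemma sum_block: "(\<Sum>j | d j = m. w (d j) powr p * c (d j)) = c m"
proof -
  have "(\<Sum>j | d j = m. w (d j) powr p * c (d j)) = (\<Sum>j | d j = m. w m powr p * c m)"
    by (intro sum.cong) auto
  then show ?thesis using block_mass[of m] by simp
qed

definition f :: "(nat \<Rightarrow> complex) \<Rightarrow> nat \<Rightarrow> complex"
  where "f x j = of_real (w (d j)) * x 0 ^ d j * x (Suc j)"

text \<open>The part of (c + t)^m of degree i in t. For i > m the binomial coefficient is 0, so the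
  truncated exponent m - i does no harm.\<close>

definition binom_term :: "complex \<Rightarrow> complex \<Rightarrow> nat \<Rightarrow> nat \<Rightarrow> complex"
  where "binom_term c t m i = of_nat (m choose i) * t ^ i * c ^ (m - i)"

text \<open>The part of degree i in h of w(d j) (y_0 + h_0)^(d j) (y_(j+1) + h_(j+1)): either the
  power supplies all i factors, or it supplies i - 1 of them and the last one is h_(j+1), which is
  impossible for i = 0.\<close>

definition taylor :: "(nat \<Rightarrow> complex) \<Rightarrow> nat \<Rightarrow> (nat \<Rightarrow> complex) \<Rightarrow> nat \<Rightarrow> complex"
  where "taylor y i h j = of_real (w (d j)) * (binom_term (y 0) (h 0) (d j) i * y (Suc j)
    + (case i of 0 \<Rightarrow> 0 | Suc k \<Rightarrow> binom_term (y 0) (h 0) (d j) k * h (Suc j)))"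

lemma w_power_bounded:
  obtains C where "\<And>m. w m * R ^ m \<le> C"
proof -
  have "Bseq (\<lambda>m. w m * R ^ m)" using w_rapid by (intro convergent_imp_Bseq convergentI)
  then obtain C where "\<And>m. norm (w m * R ^ m) \<le> C" by (auto simp: Bseq_def)
  then show ?thesis using that by (metis abs_le_D1 real_norm_def)
qed

text \<open>The coefficients contain binomials that are unbounded in the block index. A single
  binomial term is at most the full expansion of (norm (y 0) + 1)^m, and the rapid decay of
  \<open>w\<close> keeps that bounded.\<close>

lemma taylor_cont_hom_poly:
  assumes y: "y \<in> ncarrier (ell 1)"
  shows "cont_hom_poly (ell 1) (ell p) i (taylor y i)"
proof -
  define R where "R = norm (y 0) + 1"
  obtain C where C: "\<And>m. w m * R ^ m \<le> C" by (rule w_power_bounded[of R]) blast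
  have bt: "w m * norm (of_nat (m choose k) * y 0 ^ (m - k)) \<le> C" for m k
  proof -
    have "norm (of_nat (m choose k) * y 0 ^ (m - k)) \<le> R ^ m"
    proof (cases "k \<le> m")
      case True
      have "(\<Sum>k\<in>{k}. real (m choose k) * 1 ^ k * norm (y 0) ^ (m - k)) \<le> (\<Sum>k\<le>m. real (m choose k) * 1 ^ k * norm (y 0) ^ (m - k))"
        using True by (intro sum_mono2) auto
      also have "\<dots> = R ^ m" unfolding R_def by (subst add.commute) (rule binomial_ring[symmetric])
      finally show ?thesis by (simp add: norm_mult norm_power)
    qed (simp add: R_def binomial_eq_0 not_le)
    then have "w m * norm (of_nat (m choose k) * y 0 ^ (m - k)) \<le> w m * R ^ m"
      using w_pos by (intro mult_left_mono) (auto intro: less_imp_le)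
    with C[of m] show ?thesis by linarith
  qed
  define b where "b k j = of_real (w (d j)) * (of_nat (d j choose k) * y 0 ^ (d j - k))" for k j
  have b: "norm (b k j) \<le> C" for k j
    using bt[of "d j" k] w_pos[of "d j"] by (simp add: b_def norm_mult)
  have u: "(\<lambda>j. b k j * y (Suc j)) \<in> ncarrier (ell r)" if "1 \<le> r" for k r
    by (rule ell_bound(1)[OF that summable_mult[OF summable_Suc_ell_1[OF y]], of _ C])
      (auto simp: norm_mult intro!: mult_right_mono b)
  show ?thesis
  proof (cases i)
    case 0
    have "taylor y 0 = (\<lambda>_ j. b 0 j * y (Suc j))"
      by (simp add: fun_eq_iff taylor_def binom_term_def b_def)
    with cont_hom_poly_const[OF _ p u[OF p], of 1 0] 0 show ?thesis by simp
  next
    case (Suc k)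
    have "taylor y (Suc k) = (\<lambda>h j. h 0 ^ k * (h 0 * (b (Suc k) j * y (Suc j)) + b k j * h (Suc j)))"
      by (simp add: fun_eq_iff taylor_def binom_term_def b_def algebra_simps)
    with cont_hom_poly_power_mult_linear[OF p u[OF order_refl, of "Suc k"] b[of k], where k = k] Suc show ?thesis by simp
  qed
qed

text \<open>The second sum stops one term earlier because the factor h_(j+1) already accounts for
  one degree.\<close>

lemma sum_taylor:
  "(\<Sum>i<Suc n. taylor y i h j) = of_real (w (d j)) *
    ((\<Sum>i<Suc n. binom_term (y 0) (h 0) (d j) i) * y (Suc j) + (\<Sum>i<n. binom_term (y 0) (h 0) (d j) i) * h (Suc j))"
proof -
  have "(\<Sum>i<Suc n. case i of 0 \<Rightarrow> 0 | Suc k \<Rightarrow> binom_term (y 0) (h 0) (d j) k * h (Suc j))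
    = (\<Sum>i<n. binom_term (y 0) (h 0) (d j) i * h (Suc j))"
    by (subst sum.lessThan_Suc_shift) simp
  then show ?thesis
    unfolding taylor_def by (simp only: sum_distrib_left[symmetric] sum.distrib sum_distrib_right)
qed

text \<open>Blocks of index below n are already fully expanded, so only those from n on contribute.
  There the tails cut at n and at n + 1 have a common bound, and the restriction on h_0 makes it
  independent of h_0, as uniform convergence requires.\<close>

lemma norm_taylor_remainder_le:
  assumes h: "norm (h 0) \<le> 1"
  shows "norm (f (y + h) j - (\<Sum>i<Suc n. taylor y i h j))
    \<le> (if n \<le> d j then w (d j) * (norm (y 0) + 1) ^ d j else 0) * (norm (y (Suc j)) + norm (h (Suc j)))"
proof -
  define m where "m = d j"
  define q where "q = (if n \<le> m then (norm (y 0) + 1) ^ m else 0)"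
  let ?S = "\<lambda>n. \<Sum>i<n. binom_term (y 0) (h 0) m i"
  have *: "norm ((y 0 + h 0) ^ m - ?S n) \<le> (if n \<le> m then (norm (y 0) + 1) ^ m else 0)" for n
  proof -
    have "(norm (y 0) + norm (h 0)) ^ m \<le> (norm (y 0) + 1) ^ m" using h by (intro power_mono) auto
    then show ?thesis
      using norm_binomial_tail_le[of "y 0" "h 0" m n] unfolding binom_term_def by (auto split: if_splits)
  qed
  have q0: "norm ((y 0 + h 0) ^ m - ?S n) \<le> q" unfolding q_def by (rule *)
  have q1: "norm ((y 0 + h 0) ^ m - ?S (Suc n)) \<le> q"
    using *[of "Suc n"] unfolding q_def by (rule order_trans) (auto)
  have "f (y + h) j - (\<Sum>i<Suc n. taylor y i h j)
      = of_real (w m) * (((y 0 + h 0) ^ m - ?S (Suc n)) * y (Suc j) + ((y 0 + h 0) ^ m - ?S n) * h (Suc j))"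
    unfolding sum_taylor f_def m_def[symmetric] by (simp add: algebra_simps del: sum.lessThan_Suc)
  also have "norm \<dots> \<le> w m * (q * norm (y (Suc j)) + q * norm (h (Suc j)))"
    unfolding norm_mult norm_of_real using w_pos[of m] q0 q1
    by (intro mult_mono order_trans[OF norm_triangle_ineq] add_mono)
      (auto simp: norm_mult intro: mult_right_mono)
  finally show ?thesis by (auto simp: q_def m_def algebra_simps)
qed

lemma f_mem:
  assumes x: "x \<in> ncarrier (ell 1)"
  shows "f x \<in> ncarrier (ell p)"
proof -
  obtain C where C: "\<And>m. w m * norm (x 0) ^ m \<le> C" by (rule w_power_bounded[of "norm (x 0)"]) blast
  show ?thesis
  proof (rule ell_bound(1)[OF p summable_mult[OF summable_Suc_ell_1[OF x]]])
    show "norm (f x j) \<le> C * norm (x (Suc j))" for j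
      using w_pos[of "d j"] C[of "d j"] by (auto simp: f_def norm_mult norm_power intro: mult_right_mono)
  qed
qed

text \<open>The unit ball around y serves for every y: late remainders involve only blocks on which
  w m * R^m is below \<epsilon>, multiplied by the l_1 mass of y and h, which is at most
  \<open>M\<close>.\<close>

lemma has_taylor_expansion_f:
  assumes y: "y \<in> ncarrier (ell 1)"
  shows "has_taylor_expansion (ell 1) (ell p) f y (taylor y)"
  unfolding has_taylor_expansion_def
proof (intro conjI allI exI)
  show "openin (ntopology (ell 1)) (ell_ball 1 y 1)" by (rule openin_ell_ball[OF _ y]) simp
  show "y \<in> ell_ball 1 y 1" using y by (simp add: ell_ball_def nnorm_ell)
  show "uniform_limit (ell_ball 1 y 1) (\<lambda>n x. nnorm (ell p) (f x - (\<Sum>m<n. taylor y m (x - y)))) (\<lambda>_. 0) sequentially"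
  proof (rule uniform_limitI)
    fix e :: real assume e: "e > 0"
    define R where "R = norm (y 0) + 1"
    define M where "M = nnorm (ell 1) y + 1"
    define \<epsilon> where "\<epsilon> = e / (M + 1)"
    have M: "M > 0" using nnorm_ell_nonneg[of 1 y] by (simp add: M_def)
    have \<epsilon>: "\<epsilon> > 0" "\<epsilon> * M < e" using e M by (simp_all add: \<epsilon>_def field_simps)
    obtain N where N: "\<And>m. m \<ge> N \<Longrightarrow> norm (w m * R ^ m) < \<epsilon>"
      using LIMSEQ_D[OF w_rapid \<epsilon>(1), of R] by auto
    have "nnorm (ell p) (f x - (\<Sum>m<n. taylor y m (x - y))) < e"
      if n: "n \<ge> Suc N" and x: "x \<in> ell_ball 1 y 1" for n x
    proof -
      obtain n' where n': "n = Suc n'" "n' \<ge> N" using n by (cases n) auto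
      define h where "h = x - y"
      have x1: "x \<in> ncarrier (ell 1)" and h1: "nnorm (ell 1) h < 1"
        using x by (auto simp: ell_ball_def h_def)
      have h: "h \<in> ncarrier (ell 1)" unfolding h_def by (rule diff_ell[OF _ x1 y]) simp
      have h0: "norm (h 0) \<le> 1" using norm_le_nnorm_ell[OF h, of 0] h1 by simp
      let ?g = "\<lambda>j. \<epsilon> * (norm (y (Suc j)) + norm (h (Suc j)))"
      have sg: "summable ?g" by (intro summable_mult summable_add summable_Suc_ell_1 y h)
      have "norm ((f x - (\<Sum>m<n. taylor y m h)) j) \<le> ?g j" for j
      proof -
        have "(if n' \<le> d j then w (d j) * R ^ d j else 0) \<le> \<epsilon>"
          using N[of "d j"] n' \<epsilon>(1) by (auto simp: abs_less_iff)
        then have "(if n' \<le> d j then w (d j) * R ^ d j else 0) * (norm (y (Suc j)) + norm (h (Suc j))) \<le> ?g j"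
          by (rule mult_right_mono) simp
        then show ?thesis
          using norm_taylor_remainder_le[where h=h and y=y and j=j and n=n', OF h0] unfolding R_def[symmetric]
          by (simp add: sum_fun_apply n' h_def del: sum.lessThan_Suc)
      qed
      from ell_bound(2)[OF p sg this]
      have "nnorm (ell p) (f x - (\<Sum>m<n. taylor y m h)) \<le> suminf ?g" .
      also have "\<dots> = \<epsilon> * ((\<Sum>j. norm (y (Suc j))) + (\<Sum>j. norm (h (Suc j))))"
        using summable_Suc_ell_1[OF y] summable_Suc_ell_1[OF h]
        by (simp add: suminf_mult suminf_add summable_add)
      also have "\<dots> \<le> \<epsilon> * M"
        using suminf_Suc_le_nnorm_ell_1[OF y] suminf_Suc_le_nnorm_ell_1[OF h] h1 \<epsilon>(1)
        by (intro mult_left_mono) (auto simp: M_def)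
      finally show ?thesis using \<epsilon>(2) by (simp add: h_def)
    qed
    then show "\<forall>\<^sub>F n in sequentially. \<forall>x\<in>ell_ball 1 y 1.
        dist (nnorm (ell p) (f x - (\<Sum>m<n. taylor y m (x - y)))) 0 < e"
      by (auto simp: eventually_sequentially dist_real_def nnorm_ell_nonneg)
  qed
qed (rule taylor_cont_hom_poly[OF y])

lemma f_entire: "f \<in> entire (ell 1) (ell p)"
  unfolding entire_def using f_mem has_taylor_expansion_f by blast

lemma taylor_poly_f_0:
  assumes "x \<in> ncarrier (ell 1)"
  shows "taylor_poly (ell 1) (ell p) f 0 m x = taylor 0 m x"
proof (rule has_taylor_expansion_unique[OF _ p _ _ has_taylor_expansion_f[OF zero_mem_ell] assms])
  show "has_taylor_expansion (ell 1) (ell p) f 0 (taylor_poly (ell 1) (ell p) f 0)"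
    unfolding taylor_poly_def by (rule someI[of _ "taylor 0"]) (rule has_taylor_expansion_f[OF zero_mem_ell])
qed (use f_mem in auto)

section \<open>The Taylor polynomials at 0 and their \<open>p\<close>-compact norms\<close>

lemma taylor_0_0: "taylor 0 0 h = 0"
  by (simp add: taylor_def fun_eq_iff)

text \<open>With y = 0 the factor 0^(d j - k) kills the blocks of index above k and the binomial
  coefficient those below, so degree k + 1 lives exactly on block k.\<close>

lemma taylor_0_Suc:
  "taylor 0 (Suc k) h j = (if d j = k then of_real (w k) * h 0 ^ k * h (Suc j) else 0)"
  by (auto simp: taylor_def binom_term_def)

lemma diag_block_sums:
  "(\<lambda>j. norm (if d j = k then of_real (w k) else 0 :: complex) powr p) sums 1"
proof -
  have "(\<lambda>j. norm (if d j = k then of_real (w k) else 0 :: complex) powr p)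
    = (\<lambda>j. if j \<in> {j. d j = k} then w k powr p else 0)"
    using w_pos[of k] by (auto simp: fun_eq_iff)
  moreover have "(\<lambda>j. if j \<in> {j. d j = k} then w k powr p else 0) sums (\<Sum>j | d j = k. w k powr p)"
    by (rule sums_If_finite_set[OF finite_block])
  ultimately show ?thesis by (simp add: block_mass)
qed

lemma power_mult_shift_mem_unit_cball:
  assumes x: "x \<in> ncarrier (ell 1)" "nnorm (ell 1) x \<le> 1" and c: "\<And>j. norm (c j) \<le> 1"
  shows "(\<lambda>j. c j * x (Suc j)) \<in> unit_cball (ell 1)"
proof -
  have le: "norm (c j * x (Suc j)) \<le> norm (x (Suc j))" for j
    using c[of j] by (simp add: norm_mult mult_left_le_one_le)
  have "nnorm (ell 1) (\<lambda>j. c j * x (Suc j)) \<le> (\<Sum>j. norm (x (Suc j)))"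
    by (rule ell_bound(2)[OF _ summable_Suc_ell_1[OF x(1)] le]) simp
  with suminf_Suc_le_nnorm_ell_1[OF x(1)] x(2) show ?thesis
    using ell_bound(1)[OF _ summable_Suc_ell_1[OF x(1)] le, of 1] by (simp add: unit_cball_def)
qed

text \<open>The scalar power of x_0 has modulus at most 1 and is absorbed into the coefficients; the
  diagonal of one block has l_p norm 1. The same sequence yields p-compactness, the upper bound for
  \<open>kappa\<close>, and nonemptiness of the set whose infimum defines it.\<close>

lemma taylor_image_subset_p_co:
  "\<exists>y\<in>ncarrier (lp p (ell p)). nnorm (lp p (ell p)) y = 1 \<and>
    taylor_poly (ell 1) (ell p) f 0 m ` unit_cball (ell 1) \<subseteq> p_co p (ell p) y"
proof -
  define b where "b j = (if d j = m - 1 then of_real (w (m - 1)) else 0 :: complex)" for j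
  have b: "(\<lambda>j. norm (b j) powr p) sums 1" unfolding b_def by (rule diag_block_sums)
  have "taylor_poly (ell 1) (ell p) f 0 m x \<in> p_co p (ell p) (diag_seq b)"
    if x: "x \<in> unit_cball (ell 1)" for x
  proof -
    have x1: "x \<in> ncarrier (ell 1)" "nnorm (ell 1) x \<le> 1" using x by (auto simp: unit_cball_def)
    \<comment> \<open>For m = 0 the polynomial is zero while m - 1 truncates to 0 and selects block
      0; the value c = 0 covers this case with the same norm 1.\<close>
    define c where "c = (if m = 0 then 0 else x 0 ^ (m - 1))"
    have "norm (x 0) \<le> 1" using norm_le_nnorm_ell[OF x1(1), of 0] x1(2) by simp
    then have c: "norm c \<le> 1" by (auto simp: c_def norm_power intro: power_le_one)
    have "taylor_poly (ell 1) (ell p) f 0 m x = (\<lambda>j. c * x (Suc j) * b j)"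
      unfolding taylor_poly_f_0[OF x1(1)]
      by (cases m) (auto simp: fun_eq_iff c_def b_def taylor_0_0 taylor_0_Suc)
    with mult_mem_p_co_diag_seq[OF p sums_summable[OF b] power_mult_shift_mem_unit_cball[OF x1, of "\<lambda>_. c"]] c
    show ?thesis by simp
  qed
  moreover have "diag_seq b \<in> ncarrier (lp p (ell p))" "nnorm (lp p (ell p)) (diag_seq b) = 1"
    using diag_seq_lp[OF p sums_summable[OF b]] sums_unique[OF b] by simp_all
  ultimately show ?thesis by blast
qed

lemma p_compact_poly_taylor: "p_compact_poly p (ell 1) (ell p) (taylor_poly (ell 1) (ell p) f 0 m)"
  unfolding p_compact_poly_def rel_p_compact_def
  using taylor_image_subset_p_co[of m] p_co_subset_closure by (meson order_trans)

lemma kappa_taylor_le_1: "kappa p (ell 1) (ell p) (taylor_poly (ell 1) (ell p) f 0 m) \<le> 1"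
proof -
  obtain y where "y \<in> ncarrier (lp p (ell p))" "nnorm (lp p (ell p)) y = 1"
    "taylor_poly (ell 1) (ell p) f 0 m ` unit_cball (ell 1) \<subseteq> p_co p (ell p) y"
    using taylor_image_subset_p_co by blast
  then show ?thesis
    unfolding kappa_def m_p_def by (intro cInf_lower2[of 1]) (auto simp: nnorm_lp_ell intro!: bdd_belowI[of _ 0])
qed

text \<open>Test vectors for both lower bounds: the entry at 0 feeds the power of x_0, the entry at
  Suc j reaches coordinate j of the image.\<close>

lemma two_point_ell_1:
  defines "z \<equiv> \<lambda>s t j n. if n = 0 then s else if n = Suc j then t else (0 :: complex)"
  shows "z s t j \<in> ncarrier (ell 1)" and "nnorm (ell 1) (z s t j) = norm s + norm t"
proof -
  have "(\<lambda>n. if n \<in> {0, Suc j} then norm (z s t j n) else 0) sums (\<Sum>n\<in>{0, Suc j}. norm (z s t j n))"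
    by (rule sums_If_finite_set) simp
  moreover have "(\<lambda>n. if n \<in> {0, Suc j} then norm (z s t j n) else 0) = (\<lambda>n. norm (z s t j n))"
    by (auto simp: z_def fun_eq_iff)
  ultimately have *: "(\<lambda>n. norm (z s t j n)) sums (norm s + norm t)" by (simp add: z_def)
  then show "z s t j \<in> ncarrier (ell 1)" by (simp add: mem_ell_1 sums_summable)
  then show "nnorm (ell 1) (z s t j) = norm s + norm t" using sums_unique[OF *] by (simp add: nnorm_ell_1)
qed

text \<open>On the l_1 sphere the weight a at coordinate 0 leaves 1 - a for coordinate Suc j, and
  a^(m-1) (1 - a) is largest at a = 1 - 1/m, where it equals \<theta>. As \<theta> does not depend
  on j, all coordinates of block m - 1 reach \<open>w (m - 1)\<close> times \<theta>, and their p-th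
  powers add up to \<theta>^p. For m = 1 the power reads 0^0 = 1.\<close>

lemma kappa_taylor_ge:
  assumes m: "m \<ge> 1"
  shows "(1 - 1 / real m) ^ (m - 1) / real m \<le> kappa p (ell 1) (ell p) (taylor_poly (ell 1) (ell p) f 0 m)"
  unfolding kappa_def m_p_def
proof (rule cInf_greatest)
  define \<theta> where "\<theta> = (1 - 1 / real m) ^ (m - 1) / real m"
  define k where "k = m - 1"
  have \<theta>0: "\<theta> \<ge> 0" using m by (simp add: \<theta>_def)
  let ?P = "taylor_poly (ell 1) (ell p) f 0 m"
  show "{nnorm (lp p (ell p)) y |y. y \<in> ncarrier (lp p (ell p)) \<and> ?P ` unit_cball (ell 1) \<subseteq> p_co p (ell p) y} \<noteq> {}"
    using taylor_image_subset_p_co[of m] by blast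
  fix r assume "r \<in> {nnorm (lp p (ell p)) y |y. y \<in> ncarrier (lp p (ell p)) \<and> ?P ` unit_cball (ell 1) \<subseteq> p_co p (ell p) y}"
  then obtain y where y: "y \<in> ncarrier (lp p (ell p))" and r: "r = nnorm (lp p (ell p)) y"
    and sub: "?P ` unit_cball (ell 1) \<subseteq> p_co p (ell p) y" by blast
  have "(\<Sum>j | d j = k. (w (d j) * \<theta>) powr p) \<le> nnorm (lp p (ell p)) y powr p"
  proof (rule sum_coord_le_nnorm_lp[OF p y order_trans[OF sub p_co_subset_closure] finite_block])
    fix j assume "j \<in> {j. d j = k}"
    then have j: "d j = k" by simp
    define z where "z n = (if n = 0 then of_real (1 - 1 / real m) else if n = Suc j then of_real (1 / real m) else (0::complex))" for n
    have nz: "norm (complex_of_real (1 - 1 / real m)) + norm (complex_of_real (1 / real m)) = 1"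
      using m unfolding norm_of_real by simp
    have z: "z \<in> ncarrier (ell 1)" "nnorm (ell 1) z = 1"
      using two_point_ell_1[of "of_real (1 - 1 / real m)" j "of_real (1 / real m)"] nz unfolding z_def[abs_def] by auto
    have "m = Suc k" using m by (simp add: k_def)
    then have "?P z j = of_real (w k * \<theta>)"
      unfolding taylor_poly_f_0[OF z(1)] by (simp add: taylor_0_Suc j z_def \<theta>_def)
    then have "w (d j) * \<theta> \<le> norm (?P z j)" using j by (simp del: of_real_mult)
    with z \<theta>0 w_pos[of "d j"] show "0 \<le> w (d j) * \<theta> \<and> (\<exists>z\<in>?P ` unit_cball (ell 1). w (d j) * \<theta> \<le> norm (z j))"
      by (auto simp: unit_cball_def)
  qed
  also have "(\<Sum>j | d j = k. (w (d j) * \<theta>) powr p) = \<theta> powr p"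
    using sum_block[where m = k and c = "\<lambda>_. \<theta> powr p"] w_pos \<theta>0 by (simp add: powr_mult less_imp_le)
  finally have "(\<theta> powr p) powr (1/p) \<le> (nnorm (lp p (ell p)) y powr p) powr (1/p)"
    using p by (intro powr_mono2[of "1/p"]) simp_all
  moreover have "(\<theta> powr p) powr (1/p) = \<theta>" using p \<theta>0 by (simp add: powr_powr)
  moreover have "0 \<le> nnorm (lp p (ell p)) y" by (simp add: nnorm_lp_ell)
  then have "(nnorm (lp p (ell p)) y powr p) powr (1/p) = nnorm (lp p (ell p)) y"
    using p \<open>0 \<le> nnorm (lp p (ell p)) y\<close> by (simp add: powr_powr)
  ultimately show "(1 - 1 / real m) ^ (m - 1) / real m \<le> r" unfolding \<theta>_def r by argo
qed

lemma limsup_kappa_taylor: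
  "limsup (\<lambda>m. ereal (kappa p (ell 1) (ell p) (taylor_poly (ell 1) (ell p) f 0 m) powr (1 / real m))) = 1"
proof (rule lim_imp_Limsup)
  let ?\<kappa> = "\<lambda>m. kappa p (ell 1) (ell p) (taylor_poly (ell 1) (ell p) f 0 m)"
  \<comment> \<open>The quantity under the root is asymptotic to 1/(e m), so its m-th root tends to
    1.\<close>
  have low: "(\<lambda>m. ((1 - 1 / real m) ^ (m - 1) / real m) powr (1 / real m)) \<longlonglongrightarrow> 1"
    by real_asymp
  have "(\<lambda>m. ?\<kappa> m powr (1 / real m)) \<longlonglongrightarrow> 1"
  proof (rule tendsto_sandwich[OF _ _ low tendsto_const])
    show "\<forall>\<^sub>F m in sequentially. ((1 - 1 / real m) ^ (m - 1) / real m) powr (1 / real m) \<le> ?\<kappa> m powr (1 / real m)"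
      using eventually_ge_at_top[of 1] by eventually_elim (intro powr_mono2 kappa_taylor_ge; simp)
    show "\<forall>\<^sub>F m in sequentially. ?\<kappa> m powr (1 / real m) \<le> 1"
      using eventually_ge_at_top[of 1]
    proof eventually_elim
      case (elim m)
      have "0 \<le> (1 - 1 / real m) ^ (m - 1) / real m" using elim by simp
      with kappa_taylor_ge[OF elim] have "0 \<le> ?\<kappa> m" by linarith
      with kappa_taylor_le_1[of m] show ?case
        using powr_mono2[of "1 / real m" "?\<kappa> m" 1] by simp
    qed
  qed
  then show "(\<lambda>m. ereal (?\<kappa> m powr (1 / real m))) \<longlonglongrightarrow> 1" by (simp add: one_ereal_def)
qed simp

section \<open>\<open>p\<close>-compactness at 0 and its failure at the first basis vector\<close>

lemma summable_w_geometric: "summable (\<lambda>j. w (d j) powr p * (1/2) ^ d j)"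
proof (rule bounded_imp_summable)
  fix N
  let ?g = "\<lambda>j. w (d j) powr p * (1/2) ^ d j"
  \<comment> \<open>Regrouping by the values of \<open>d\<close> and completing each block met by
    {..N} leaves distinct powers of 1/2, because each block has mass 1.\<close>
  have "(\<Sum>j\<le>N. ?g j) = (\<Sum>m\<in>d ` {..N}. \<Sum>j | j \<in> {..N} \<and> d j = m. ?g j)"
    by (rule sum.image_gen) simp
  also have "\<dots> \<le> (\<Sum>m\<in>d ` {..N}. \<Sum>j | d j = m. ?g j)"
    by (intro sum_mono sum_mono2 finite_block) auto
  also have "\<dots> = (\<Sum>m\<in>d ` {..N}. (1/2) ^ m)" by (simp only: sum_block)
  also have "\<dots> \<le> (\<Sum>m. (1/2) ^ m)"
    by (intro sum_le_suminf summable_geometric) auto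
  finally show "(\<Sum>j\<le>N. ?g j) \<le> (\<Sum>m. (1/2) ^ m)" .
qed simp

text \<open>
  On the ball of radius \<open>1/2\<close> write \<open>x\<^sub>0\<^sup>m = (2x\<^sub>0)\<^sup>m 2\<^sup>-\<^sup>m\<close>: the first factor is bounded by \<open>1\<close>,
  and the second makes the block masses summable.
\<close>

lemma p_compact_at_0: "p_compact_at p (ell 1) (ell p) f 0"
  unfolding p_compact_at_def rel_p_compact_def
proof (intro exI conjI)
  show "openin (ntopology (ell 1)) (ell_ball 1 0 (1/2))" by (rule openin_ell_ball) simp_all
  show "0 \<in> ell_ball 1 0 (1/2)" by (simp add: ell_ball_def nnorm_ell)
  define b where "b j = complex_of_real (w (d j) * (1/2) ^ d j)" for j
  have "summable (\<lambda>j. norm (b j) powr p)"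
  proof (rule summable_comparison_test'[OF summable_w_geometric, of 0])
    fix j
    have "((1/2) ^ d j) powr p \<le> ((1/2) ^ d j :: real) powr 1"
      using p by (intro powr_mono') (auto intro: power_le_one)
    then have "w (d j) powr p * ((1/2) ^ d j) powr p \<le> w (d j) powr p * (1/2) ^ d j"
      by (intro mult_left_mono) auto
    moreover have "norm (b j) powr p = w (d j) powr p * ((1/2) ^ d j) powr p"
      unfolding b_def norm_of_real using w_pos[of "d j"] by (simp add: powr_mult abs_mult)
    ultimately show "norm (norm (b j) powr p) \<le> w (d j) powr p * (1/2) ^ d j" by simp
  qed
  note b = diag_seq_lp(1)[OF p this] mult_mem_p_co_diag_seq[OF p this]
  have "f x \<in> p_co p (ell p) (diag_seq b)" if "x \<in> ell_ball 1 0 (1/2)" for x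
  proof -
    have x: "x \<in> ncarrier (ell 1)" "nnorm (ell 1) x < 1/2" using that by (auto simp: ell_ball_def)
    have "norm (2 * x 0) \<le> 1" using norm_le_nnorm_ell[OF x(1), of 0] x(2) by (simp add: norm_mult)
    then have "norm ((2 * x 0) ^ d j) \<le> 1" for j unfolding norm_power by (intro power_le_one) auto
    then have "(\<lambda>j. (2 * x 0) ^ d j * x (Suc j)) \<in> unit_cball (ell 1)"
      using x by (intro power_mult_shift_mem_unit_cball) auto
    from b(2)[OF this] have "(\<lambda>j. (2 * x 0) ^ d j * x (Suc j) * b j) \<in> p_co p (ell p) (diag_seq b)" .
    moreover have "f x = (\<lambda>j. (2 * x 0) ^ d j * x (Suc j) * b j)"
      by (simp add: fun_eq_iff f_def b_def power_mult_distrib power_one_over)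
    ultimately show ?thesis by simp
  qed
  then show "\<exists>y\<in>ncarrier (lp p (ell p)). f ` ell_ball 1 0 (1/2) \<subseteq> ntopology (ell p) closure_of p_co p (ell p) y"
    using b(1) p_co_subset_closure by blast
qed

text \<open>
  Near \<open>unit_seq 0\<close> the powers of \<open>x\<^sub>0\<close> no longer help: adding \<open>s\<close> times \<open>unit_seq (Suc j)\<close> to it produces
  the coordinate \<open>s w (d j)\<close> of the image, and the \<open>p\<close>-th powers of these sum to \<open>s\<^sup>p\<close> on each of the infinitely many blocks.
\<close>

lemma not_p_compact_at_unit_seq_0: "\<not> p_compact_at p (ell 1) (ell p) f (unit_seq 0)"
proof
  assume "p_compact_at p (ell 1) (ell p) f (unit_seq 0)"
  then obtain V y where V: "openin (ntopology (ell 1)) V" "unit_seq 0 \<in> V"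
    and y: "y \<in> ncarrier (lp p (ell p))"
    and sub: "f ` V \<subseteq> ntopology (ell p) closure_of p_co p (ell p) y"
    by (auto simp: p_compact_at_def rel_p_compact_def)
  obtain r where r: "r > 0"
    and rV: "\<And>x. x \<in> ncarrier (ell 1) \<Longrightarrow> nnorm (ell 1) (x - unit_seq 0) < r \<Longrightarrow> x \<in> V"
    using openin_ellD[OF _ V] by auto
  define s where "s = r / 2"
  have s: "0 < s" "s < r" using r by (auto simp: s_def)
  \<comment> \<open>A single sequence y of finite norm would have to pay s^p for each of M disjoint
    blocks, with M arbitrary and s fixed by the neighbourhood.\<close>
  have "real M * s powr p \<le> nnorm (lp p (ell p)) y powr p" for M
  proof -
    have "(\<Sum>j\<in>(\<Union>m<M. {j. d j = m}). (w (d j) * s) powr p) \<le> nnorm (lp p (ell p)) y powr p"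
    proof (rule sum_coord_le_nnorm_lp[OF p y sub])
      show "finite (\<Union>m<M. {j. d j = m})" using finite_block by blast
      fix j
      define z where "z n = (if n = 0 then 1 else if n = Suc j then of_real s else (0::complex))" for n
      have z: "z \<in> ncarrier (ell 1)" using two_point_ell_1(1)[of 1 j "of_real s"] by (simp add: z_def[abs_def])
      have "z - unit_seq 0 = (\<lambda>n. if n = 0 then 0 else if n = Suc j then of_real s else 0)"
        by (auto simp: z_def unit_seq_def fun_eq_iff)
      then have "nnorm (ell 1) (z - unit_seq 0) = s"
        using two_point_ell_1(2)[of 0 j "of_real s"] s by simp
      with rV[OF z] s have "z \<in> V" by simp
      moreover have "norm (f z j) = w (d j) * s" using s w_pos[of "d j"] by (simp add: f_def z_def norm_mult)
      ultimately show "0 \<le> w (d j) * s \<and> (\<exists>z\<in>f ` V. w (d j) * s \<le> norm (z j))"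
        using s w_pos[of "d j"] by (intro conjI bexI[of _ "f z"] imageI) simp_all
    qed
    also have "(\<Sum>j\<in>(\<Union>m<M. {j. d j = m}). (w (d j) * s) powr p)
        = (\<Sum>m<M. \<Sum>j | d j = m. (w (d j) * s) powr p)"
      by (rule sum.UNION_disjoint) (auto simp: finite_block)
    also have "(\<Sum>j | d j = m. (w (d j) * s) powr p) = s powr p" for m
      using sum_block[where m = m and c = "\<lambda>_. s powr p"] w_pos s by (simp add: powr_mult less_imp_le)
    then have "(\<Sum>m<M. \<Sum>j | d j = m. (w (d j) * s) powr p) = real M * s powr p" by simp
    finally show ?thesis .
  qed
  moreover obtain M where "real M > nnorm (lp p (ell p)) y powr p / s powr p"
    using reals_Archimedean2 by blast
  ultimately show False using s by (simp add: divide_less_eq not_less[symmetric])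
qed

end

lemma ex_weighted_blocks:
  assumes p: "1 \<le> p"
  shows "\<exists>d w. weighted_blocks p d w"
proof -
  obtain d :: "nat \<Rightarrow> nat" where d: "\<And>m. card {j. d j = m} = 2 ^ (m * m)"
    using ex_fibres_card[of "\<lambda>m. 2 ^ (m * m)"] by auto
  \<comment> \<open>The exponent is dictated by the block size 2^(m*m) and block mass 1; being
    quadratic in m, it outweighs every R^m.\<close>
  define w :: "nat \<Rightarrow> real" where "w m = 2 powr (- (real m * real m / p))" for m
  have "weighted_blocks p d w"
  proof
    show "1 \<le> p" "0 < w m" for m using p by (auto simp: w_def)
    show "real (card {j. d j = m}) * w m powr p = 1" for m
    proof -
      have "real (card {j. d j = m}) = 2 powr (real m * real m)"
        using powr_realpow[of 2 "m * m"] by (simp add: d)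
      moreover have "w m powr p = 2 powr (- (real m * real m))" using p by (simp add: w_def powr_powr)
      ultimately show ?thesis by (simp flip: powr_add)
    qed
    fix R :: real
    \<comment> \<open>A base above 1 avoids the cases R = 0 and R < 0 in the asymptotics; the
      general case follows by comparison.\<close>
    have "(\<lambda>m. w m * (\<bar>R\<bar> + 2) ^ m) \<longlonglongrightarrow> 0"
    proof -
      have "(\<lambda>m. 2 powr (- (real m * real m / p)) * S ^ m) \<longlonglongrightarrow> 0" if "p > 0" "S > 1" for S
        using that by real_asymp
      then show ?thesis unfolding w_def using p by simp
    qed
    then show "(\<lambda>m. w m * R ^ m) \<longlonglongrightarrow> 0"
    proof (rule Lim_null_comparison[rotated], intro always_eventually allI)
      fix m
      have "\<bar>R\<bar> ^ m \<le> (\<bar>R\<bar> + 2) ^ m" by (intro power_mono) auto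
      then show "norm (w m * R ^ m) \<le> w m * (\<bar>R\<bar> + 2) ^ m"
        by (simp add: w_def abs_mult power_abs)
    qed
  qed
  then show ?thesis by blast
qed

theorem mainTheorem6:
  fixes p :: real
  assumes "1 \<le> p"
  shows "\<exists>f \<in> entire (ell 1) (ell p).
    p_compact_at p (ell 1) (ell p) f 0 \<and>
    (\<forall>m. p_compact_poly p (ell 1) (ell p) (taylor_poly (ell 1) (ell p) f 0 m)) \<and>
    limsup (\<lambda>m. ereal (kappa p (ell 1) (ell p) (taylor_poly (ell 1) (ell p) f 0 m) powr (1 / real m))) = 1 \<and>
    \<not> p_compact_at p (ell 1) (ell p) f (unit_seq 0)"
proof -
  obtain d w where "weighted_blocks p d w" using ex_weighted_blocks[OF assms] by blast
  then interpret weighted_blocks p d w .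
  show ?thesis
    by (intro bexI[of _ f] conjI allI f_entire p_compact_at_0 p_compact_poly_taylor
        limsup_kappa_taylor not_p_compact_at_unit_seq_0)
qed

end
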